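(* Let $V$ be any vertex algebra and let $\{E_n\}_{n\in\mathbb{Z}}$, $E_n=E_n(V)$, be the canonical decreasing sequence of subspaces of $V$ defined in the context. Set $\mathrm{gr}_{\mathcal{E}}(V)=\coprod_{n\ge 0}E_n/E_{n+1}$. Then $\mathrm{gr}_{\mathcal{E}}(V)$ equipped with the (well-defined) multiplication $$(a+E_{r+1})(b+E_{s+1})=a_{-1}b+E_{r+s+1}\qquad (a\in E_r,\ b\in E_s,\ r,s\in\mathbb{N})$$ is a commutative and associative $\mathbb{N}$-graded algebra with $\mathbf{1}+E_1\in E_0/E_1$ as identity and with a derivation $\partial$ defined by $$\partial(u+E_{n+1})=\mathcal{D}(u)+E_{n+2}\qquad (u\in E_n,\ n\in\mathbb{N}).$$ Furthermore, $\mathrm{gr}_{\mathcal{E}}(V)$ is a vertex Poisson algebra, where $$Y_-(a+E_{r+1},x)(b+E_{s+1})=\sum_{n\ge 0}(a_nb+E_{r+s-n+1})x^{-n-1}$$ for $a\in E_r$, $b\in E_s$ with $r,s\in\mathbb{N}$.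
   Context: Vector spaces are over $\mathbb{C}$ and $\mathbb{N}=\{0,1,2,\dots\}$. For a vertex algebra $V$ with vacuum $\mathbf{1}$ write $Y(u,x)=\sum_{n\in\mathbb{Z}}u_nx^{-n-1}$, and let $\mathcal{D}$ be the linear operator on $V$ with $\mathcal{D}v=v_{-2}\mathbf{1}$. For $n\in\mathbb{Z}$, $E_n(V)$ is the linear span of the vectors $u^{(1)}_{-1-k_1}\cdots u^{(r)}_{-1-k_r}v$ for $r\ge 1$, $u^{(1)},\dots,u^{(r)},v\in V$, $k_1,\dots,k_r\ge 0$ with $k_1+\cdots+k_r\ge n$. (In particular $E_n(V)=V$ for $n\le 0$ and $E_n\supset E_{n+1}$. A coset $a_nb+E_{r+s-n+1}$ is regarded as an element of $E_{r+s-n}/E_{r+s-n+1}$, which is zero when $r+s-n<0$.) A vertex Lie algebra is a vector space $A$ with a linear operator $D$ and a linear map $Y_-:A\to \mathrm{Hom}(A,x^{-1}A[x^{-1}])$, $v\mapsto Y_-(v,x)=\sum_{n\ge 0}v_nx^{-n-1}$, such that for $u,v\in A$, $m,n\in\mathbb{N}$: $(Dv)_n=-nv_{n-1}$; $u_mv=\sum_{i\ge 0}(-1)^{m+i+1}\frac{1}{i!}D^iv_{m+i}u$; and $[u_m,v_n]=\sum_{i=0}^m\binom{m}{i}(u_iv)_{m+n-i}$. A vertex Poisson algebra is a unital commutative associative algebra $A$ with a derivation $\partial$, together with a vertex Lie algebra structure $(Y_-,\partial)$ (i.e. with $D=\partial$) such that for all $a\in A$, $n\ge 0$, the coefficient $a_n$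 of $Y_-(a,x)$ is a derivation of the associative algebra $A$. *)

theory Defs
  imports Complex_Main "HOL-Library.Set_Algebras" "HOL-Library.Groups_Big_Fun"
    "HOL-Algebra.Module" "HOL-Algebra.Algebraic_Closure_Type"
begin

text \<open>
  \<open>Y u n v\<close> is \<open>u\<^sub>n v\<close>, the coefficient of \<open>x\<^sup>-\<^sup>n\<^sup>-\<^sup>1\<close> in \<open>Y(u,x)v\<close>.  The axiom \<open>borcherds\<close> is the
  Jacobi identity in components: it equates the coefficients of
  \<open>x\<^sub>0\<^sup>-\<^sup>l\<^sup>-\<^sup>1 x\<^sub>1\<^sup>-\<^sup>m\<^sup>-\<^sup>1 x\<^sub>2\<^sup>-\<^sup>n\<^sup>-\<^sup>1\<close>.  By truncation all the sums over \<open>i\<close> have finite support, so that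
  \<open>Sum_any\<close> is the intended sum.
\<close>

locale vertex_algebra = vector_space scale
  for scale :: "complex \<Rightarrow> 'v::ab_group_add \<Rightarrow> 'v" +
  fixes vac :: 'v and Y :: "'v \<Rightarrow> int \<Rightarrow> 'v \<Rightarrow> 'v"
  assumes linear_right: "Vector_Spaces.linear scale scale (Y u n)"
    and linear_left: "Vector_Spaces.linear scale scale (\<lambda>u. Y u n v)"
    and truncation: "\<exists>N. \<forall>n\<ge>N. Y u n v = 0"
    and vacuum: "Y vac n v = (if n = -1 then v else 0)"
    and creation_nonneg: "n \<ge> 0 \<Longrightarrow> Y v n vac = 0"
    and creation: "Y v (-1) vac = v"
    and borcherds:
      "Sum_any (\<lambda>i::nat. scale (of_int m gchoose i) (Y (Y u (l + int i) v) (m + n - int i) w)) =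
       Sum_any (\<lambda>i::nat. scale ((-1) ^ i * (of_int l gchoose i))
         (Y u (m + l - int i) (Y v (n + int i) w)
          - scale ((-1) powi l) (Y v (n + l - int i) (Y u (m + int i) w))))"

definition va_D :: "'v \<Rightarrow> ('v \<Rightarrow> int \<Rightarrow> 'v \<Rightarrow> 'v) \<Rightarrow> 'v \<Rightarrow> 'v" where
  "va_D vac Y v = Y v (-2) vac"

text \<open>The pairs in the list \<open>us\<close> are \<open>(u\<^sup>(\<^sup>j\<^sup>), k\<^sub>j)\<close>.\<close>

definition va_E ::
  "(complex \<Rightarrow> 'v::ab_group_add \<Rightarrow> 'v) \<Rightarrow> ('v \<Rightarrow> int \<Rightarrow> 'v \<Rightarrow> 'v) \<Rightarrow> int \<Rightarrow> 'v set" where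
  "va_E scale Y n = Modules.module.span scale
     {foldr (\<lambda>(u, k). Y u (-1 - int k)) us v | us v.
        us \<noteq> [] \<and> n \<le> int (sum_list (map snd us))}"


abbreviation complex_ring :: "complex ring" where
  "complex_ring \<equiv> ring_of_type_algebra"

definition linear_endo :: "('a, 'c) ring_scheme \<Rightarrow> ('a, 'b, 'd) module_scheme \<Rightarrow> ('b \<Rightarrow> 'b) \<Rightarrow> bool"
  where "linear_endo R M f \<longleftrightarrow>
    f \<in> carrier M \<rightarrow> carrier M \<and>
    (\<forall>x\<in>carrier M. \<forall>y\<in>carrier M. f (x \<oplus>\<^bsub>M\<^esub> y) = f x \<oplus>\<^bsub>M\<^esub> f y) \<and>
    (\<forall>c\<in>carrier R. \<forall>x\<in>carrier M. f (c \<odot>\<^bsub>M\<^esub> x) = c \<odot>\<^bsub>M\<^esub> f x)"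

definition derivation :: "('a, 'c) ring_scheme \<Rightarrow> ('a, 'b, 'd) module_scheme \<Rightarrow> ('b \<Rightarrow> 'b) \<Rightarrow> bool"
  where "derivation R A d \<longleftrightarrow> linear_endo R A d \<and>
    (\<forall>x\<in>carrier A. \<forall>y\<in>carrier A. d (x \<otimes>\<^bsub>A\<^esub> y) = d x \<otimes>\<^bsub>A\<^esub> y \<oplus>\<^bsub>A\<^esub> x \<otimes>\<^bsub>A\<^esub> d y)"

text \<open>\<open>algebra\<close> is the library's notion of a commutative, associative, unital algebra.\<close>

locale nat_graded_algebra = algebra R A
  for R :: "('a, 'c) ring_scheme" and A :: "('a, 'b, 'd) module_scheme" (structure) +
  fixes G :: "nat \<Rightarrow> 'b set"
  assumes component_submodule: "submodule (G n) R A"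
    and component_mult: "x \<in> G m \<Longrightarrow> y \<in> G n \<Longrightarrow> x \<otimes> y \<in> G (m + n)"
    and component_one: "\<one> \<in> G 0"
    and direct_sum: "x \<in> carrier A \<Longrightarrow>
      \<exists>!f. (\<forall>n. f n \<in> G n) \<and> finite {n. f n \<noteq> \<zero>} \<and> x = (\<Oplus>n\<in>{n. f n \<noteq> \<zero>}. f n)"

text \<open>
  \<open>Ym u n v\<close> is \<open>u\<^sub>n v\<close> for \<open>n \<ge> 0\<close>.  In \<open>skew_symmetry\<close> the sum is over those \<open>i\<close> whose summand is
  nonzero; they are finitely many by \<open>truncation\<close>.
\<close>

locale vertex_lie_algebra = module complex_ring A
  for A :: "(complex, 'b, 'd) module_scheme" (structure) +
  fixes D :: "'b \<Rightarrow> 'b" and Ym :: "'b \<Rightarrow> nat \<Rightarrow> 'b \<Rightarrow> 'b"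
  assumes D_linear: "linear_endo complex_ring A D"
    and linear_right: "u \<in> carrier A \<Longrightarrow> linear_endo complex_ring A (Ym u n)"
    and linear_left: "v \<in> carrier A \<Longrightarrow> linear_endo complex_ring A (\<lambda>u. Ym u n v)"
    and truncation: "u \<in> carrier A \<Longrightarrow> v \<in> carrier A \<Longrightarrow> \<exists>N. \<forall>n\<ge>N. Ym u n v = \<zero>"
    and D_mode: "v \<in> carrier A \<Longrightarrow> w \<in> carrier A \<Longrightarrow>
      Ym (D v) n w = (if n = 0 then \<zero> else (- of_nat n) \<odot> Ym v (n - 1) w)"
    and skew_symmetry: "u \<in> carrier A \<Longrightarrow> v \<in> carrier A \<Longrightarrow>
      Ym u m v =
        (let t = (\<lambda>i. ((-1) ^ (m + i + 1) * (1 / fact i)) \<odot> (D ^^ i) (Ym v (m + i) u))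
         in \<Oplus>i\<in>{i. t i \<noteq> \<zero>}. t i)"
    and commutator: "u \<in> carrier A \<Longrightarrow> v \<in> carrier A \<Longrightarrow> w \<in> carrier A \<Longrightarrow>
      Ym u m (Ym v n w) \<ominus> Ym v n (Ym u m w) =
        (\<Oplus>i\<in>{..m}. of_nat (m choose i) \<odot> Ym (Ym u i v) (m + n - i) w)"

locale vertex_poisson_algebra =
  algebra complex_ring A + vertex_lie_algebra A d Ym
  for A :: "(complex, 'b, 'd) module_scheme" (structure)
    and d :: "'b \<Rightarrow> 'b" and Ym :: "'b \<Rightarrow> nat \<Rightarrow> 'b \<Rightarrow> 'b" +
  assumes d_derivation: "derivation complex_ring A d"
    and mode_derivation: "a \<in> carrier A \<Longrightarrow> derivation complex_ring A (Ym a n)"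


text \<open>
  An element of \<open>\<Coprod>\<^sub>n E\<^sub>n/E\<^sub>n\<^sub>+\<^sub>1\<close> is a function sending \<open>n\<close> to a coset in \<open>E\<^sub>n/E\<^sub>n\<^sub>+\<^sub>1\<close>, for all but finitely many \<open>n\<close> the
  zero coset \<open>E\<^sub>n\<^sub>+\<^sub>1\<close>.  \<open>gr_elt d a\<close> is \<open>a + E\<^sub>d\<^sub>+\<^sub>1\<close> placed in degree \<open>d\<close>; it is zero for \<open>d < 0\<close>.

  The operations below are defined without a choice of representatives: a product of cosets
  is the sum of \<open>E\<^sub>k\<^sub>+\<^sub>1\<close> and the set of all products of representatives.  That this is a single coset of
  the stated form is exactly well-definedness, which therefore is part of any
  formula computing these operations on all \<open>gr_elt r a\<close>.  Sums of cosets are elementwise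
  (Minkowski) sums.
\<close>

definition gr_elt ::
  "(complex \<Rightarrow> 'v::ab_group_add \<Rightarrow> 'v) \<Rightarrow> ('v \<Rightarrow> int \<Rightarrow> 'v \<Rightarrow> 'v) \<Rightarrow> int \<Rightarrow> 'v \<Rightarrow> nat \<Rightarrow> 'v set" where
  "gr_elt scale Y d a k =
     (if int k = d then a +o va_E scale Y (d + 1) else va_E scale Y (int k + 1))"

definition gr_carrier ::
  "(complex \<Rightarrow> 'v::ab_group_add \<Rightarrow> 'v) \<Rightarrow> ('v \<Rightarrow> int \<Rightarrow> 'v \<Rightarrow> 'v) \<Rightarrow> (nat \<Rightarrow> 'v set) set" where
  "gr_carrier scale Y =
     {f. (\<forall>n. \<exists>a\<in>va_E scale Y (int n). f n = a +o va_E scale Y (int n + 1)) \<and>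
         finite {n. f n \<noteq> va_E scale Y (int n + 1)}}"

definition coset_prod ::
  "(complex \<Rightarrow> 'v::ab_group_add \<Rightarrow> 'v) \<Rightarrow> ('v \<Rightarrow> int \<Rightarrow> 'v \<Rightarrow> 'v) \<Rightarrow>
   int \<Rightarrow> nat \<Rightarrow> 'v set \<Rightarrow> 'v set \<Rightarrow> 'v set" where
  "coset_prod scale Y n k S T = {Y a n b | a b. a \<in> S \<and> b \<in> T} + va_E scale Y (int k + 1)"

definition gr ::
  "(complex \<Rightarrow> 'v::ab_group_add \<Rightarrow> 'v) \<Rightarrow> 'v \<Rightarrow> ('v \<Rightarrow> int \<Rightarrow> 'v \<Rightarrow> 'v) \<Rightarrow>
   (complex, nat \<Rightarrow> 'v set) module" where
  "gr scale vac Y =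
     \<lparr> carrier = gr_carrier scale Y,
       monoid.mult = (\<lambda>f g k. \<Sum>r\<le>k. coset_prod scale Y (-1) k (f r) (g (k - r))),
       monoid.one = gr_elt scale Y 0 vac,
       ring.zero = (\<lambda>k. va_E scale Y (int k + 1)),
       ring.add = (\<lambda>f g k. f k + g k),
       module.smult = (\<lambda>c f k. scale c ` f k + va_E scale Y (int k + 1)) \<rparr>"

definition gr_component ::
  "(complex \<Rightarrow> 'v::ab_group_add \<Rightarrow> 'v) \<Rightarrow> ('v \<Rightarrow> int \<Rightarrow> 'v \<Rightarrow> 'v) \<Rightarrow> nat \<Rightarrow> (nat \<Rightarrow> 'v set) set" where
  "gr_component scale Y n = gr_elt scale Y (int n) ` va_E scale Y (int n)"

definition gr_D ::
  "(complex \<Rightarrow> 'v::ab_group_add \<Rightarrow> 'v) \<Rightarrow> 'v \<Rightarrow> ('v \<Rightarrow> int \<Rightarrow> 'v \<Rightarrow> 'v) \<Rightarrow>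
   (nat \<Rightarrow> 'v set) \<Rightarrow> nat \<Rightarrow> 'v set" where
  "gr_D scale vac Y f k =
     (if k = 0 then va_E scale Y 1 else va_D vac Y ` f (k - 1) + va_E scale Y (int k + 1))"

text \<open>The \<open>n\<close>-th mode of degrees \<open>r\<close> and \<open>s\<close> lands in degree \<open>r + s - n\<close>.\<close>

definition gr_Ym ::
  "(complex \<Rightarrow> 'v::ab_group_add \<Rightarrow> 'v) \<Rightarrow> ('v \<Rightarrow> int \<Rightarrow> 'v \<Rightarrow> 'v) \<Rightarrow>
   (nat \<Rightarrow> 'v set) \<Rightarrow> nat \<Rightarrow> (nat \<Rightarrow> 'v set) \<Rightarrow> nat \<Rightarrow> 'v set" where
  "gr_Ym scale Y f n g k = (\<Sum>r\<le>k + n. coset_prod scale Y (int n) k (f r) (g (k + n - r)))"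

end

theory Submission
  imports Defs
begin

text \<open>
  The Borcherds identity yields the commutator and iterate formulas, skew symmetry, and the
  commutation of \<open>D\<close> with the modes.  By induction along the generators of \<open>E\<^sub>n\<close> they give
  \<open>u\<^sub>n v \<in> E\<^sub>r\<^sub>+\<^sub>s\<^sub>-\<^sub>n\<^sub>-\<^sub>1\<close> for all \<open>n\<close>, and \<open>u\<^sub>n v \<in> E\<^sub>r\<^sub>+\<^sub>s\<^sub>-\<^sub>n\<close> for \<open>n \<ge> 0\<close>, whenever \<open>u \<in> E\<^sub>r\<close> and \<open>v \<in> E\<^sub>s\<close>.
  This gain of one degree for the nonnegative modes kills, in the associated graded space, the
  correction terms in the formulas for commutativity and associativity of the \<open>-1\<close> product and for
  the action of \<open>u\<^sub>n\<close> on products, while the vertex Lie identities are homogeneous and survive.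
  All identities are multilinear, so it is enough to check them on homogeneous elements.
\<close>

lemma Sum_any_eq_sum_lessThan:
  fixes f :: "nat \<Rightarrow> 'a::comm_monoid_add"
  assumes "\<And>i. N \<le> i \<Longrightarrow> f i = 0"
  shows "Sum_any f = sum f {..<N}"
  by (rule Sum_any.expand_superset) (use assms not_less in auto)

lemma gbinomial_0_left: "i > 0 \<Longrightarrow> (0 gchoose i) = (0::complex)"
  by (cases i) (auto simp: gbinomial_Suc prod.atLeast0_atMost_Suc)

section \<open>Identities in vertex algebras and the filtration\<close>

context vertex_algebra
begin

abbreviation D :: "'v \<Rightarrow> 'v" where "D \<equiv> va_D vac Y"
abbreviation E :: "int \<Rightarrow> 'v set" where "E \<equiv> va_E scale Y"

lemma Y_add_right: "Y u n (v + w) = Y u n v + Y u n w"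
  and Y_scale_right: "Y u n (scale c v) = scale c (Y u n v)"
  using linear_right[of u n] by (auto simp: Vector_Spaces.linear_iff)

lemma Y_add_left: "Y (u + v) n w = Y u n w + Y v n w"
  and Y_scale_left: "Y (scale c u) n w = scale c (Y u n w)"
  using linear_left[of n w] by (auto simp: Vector_Spaces.linear_iff)

lemma Y_zero_right [simp]: "Y u n 0 = 0"
  using Y_scale_right[of u n 0 0] by simp

lemma Y_zero_left [simp]: "Y 0 n v = 0"
  using Y_scale_left[of 0 0 n v] by simp

lemma D_add: "D (u + v) = D u + D v"
  and D_scale: "D (scale c u) = scale c (D u)"
  and D_zero [simp]: "D 0 = 0"
  by (simp_all add: va_D_def Y_add_left Y_scale_left)

lemma funpow_D_zero [simp]: "(D ^^ i) 0 = 0"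
  by (induction i) auto

section \<open>Consequences of the Borcherds identity\<close>

lemma eventually_mode_zero: "\<forall>\<^sub>F i in sequentially. Y u (n + int i) v = 0"
proof -
  obtain N where "\<forall>n\<ge>N. Y u n v = 0" using truncation by blast
  then show ?thesis
    unfolding eventually_sequentially by (intro exI[of _ "nat (N - n)"]) auto
qed

text \<open>The Borcherds identity at \<open>l = 0\<close>: its right side keeps only the summand
  \<open>i = 0\<close>, and on its left side the binomial coefficient ends the sum at
  \<open>i = m\<close>.\<close>

lemma commutator_formula:
  "Y u (int m) (Y v n w) - Y v n (Y u (int m) w)
     = (\<Sum>i\<le>m. scale (of_nat (m choose i)) (Y (Y u (int i) v) (int m + n - int i) w))"
proof -
  have "Sum_any (\<lambda>i::nat. scale (of_int (int m) gchoose i) (Y (Y u (0 + int i) v) (int m + n - int i) w))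
      = (\<Sum>i<Suc m. scale (of_nat (m choose i)) (Y (Y u (int i) v) (int m + n - int i) w))"
    by (subst Sum_any_eq_sum_lessThan[where N = "Suc m"]) (auto simp: binomial_gbinomial[symmetric])
  moreover have "Sum_any (\<lambda>i::nat. scale ((-1) ^ i * (of_int 0 gchoose i))
         (Y u (int m + 0 - int i) (Y v (n + int i) w)
          - scale ((-1) powi 0) (Y v (n + 0 - int i) (Y u (int m + int i) w))))
     = Y u (int m) (Y v n w) - Y v n (Y u (int m) w)"
    by (subst Sum_any_eq_sum_lessThan[where N = 1]) (auto simp: gbinomial_0_left)
  ultimately show ?thesis
    using borcherds[of "int m" u 0 v n w] by (simp only: lessThan_Suc_atMost)
qed

text \<open>The Borcherds identity at \<open>m = 0\<close>, where the left side keeps only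
  \<open>i = 0\<close>. The number of nonzero summands on the right depends on \<open>u\<close>,
  \<open>v\<close>, \<open>w\<close>, so the sum is taken up to every large \<open>N\<close>;
  further lower bounds on \<open>N\<close> can then be imposed at will.\<close>

lemma iterate_formula:
  "\<forall>\<^sub>F N in sequentially. Y (Y u l v) n w =
     (\<Sum>i<N. scale ((-1) ^ i * (of_int l gchoose i))
        (Y u (l - int i) (Y v (n + int i) w)
         - scale ((-1) powi l) (Y v (n + l - int i) (Y u (int i) w))))"
proof -
  have "\<forall>\<^sub>F i in sequentially. Y v (n + int i) w = 0 \<and> Y u (int i) w = 0"
    using eventually_mode_zero[of v n w] eventually_mode_zero[of u 0 w] by eventually_elim auto
  then obtain N0 where N0: "\<And>i. i \<ge> N0 \<Longrightarrow> Y v (n + int i) w = 0 \<and> Y u (int i) w = 0"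
    unfolding eventually_sequentially by blast
  have "Sum_any (\<lambda>i::nat. scale (of_int 0 gchoose i) (Y (Y u (l + int i) v) (0 + n - int i) w))
      = Y (Y u l v) n w"
    by (subst Sum_any_eq_sum_lessThan[where N = 1]) (auto simp: gbinomial_0_left)
  then have "Y (Y u l v) n w =
     (\<Sum>i<N. scale ((-1) ^ i * (of_int l gchoose i))
        (Y u (l - int i) (Y v (n + int i) w)
         - scale ((-1) powi l) (Y v (n + l - int i) (Y u (int i) w))))" if "N \<ge> N0" for N
    unfolding borcherds[of 0 u l v n w]
    by (subst (asm) Sum_any_eq_sum_lessThan[where N = N]) (use N0 that in auto)
  then show ?thesis
    unfolding eventually_sequentially by blast
qed

text \<open>The iterate formula with \<open>l = -2\<close> and \<open>vac\<close> as second vector.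
  The vacuum axiom leaves at most one nonzero summand: \<open>i = -1 - n\<close> from the first half
  when \<open>n < 0\<close>, or \<open>i = n - 1\<close> from the second half when
  \<open>n > 0\<close>.\<close>

lemma D_mode: "Y (D v) n w = - scale (of_int n) (Y v (n - 1) w)"
proof -
  let ?c = "\<lambda>i::nat. (-1) ^ i * (of_int (-2) gchoose i) :: complex"
  let ?R = "- scale (of_int n) (Y v (n - 1) w)"
  have "\<forall>\<^sub>F N in sequentially. Y (Y v (-2) vac) n w =
     (\<Sum>i<N. scale (?c i)
        (Y v (-2 - int i) (Y vac (n + int i) w)
         - scale ((-1) powi (-2)) (Y vac (n + (-2) - int i) (Y v (int i) w))))
      \<and> N > nat \<bar>n\<bar>"
    by (intro eventually_conj iterate_formula eventually_gt_at_top)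
  then obtain N where N: "Y (D v) n w = (\<Sum>i<N. scale (?c i)
        (Y v (-2 - int i) (Y vac (n + int i) w)
         - scale ((-1) powi (-2)) (Y vac (n + (-2) - int i) (Y v (int i) w))))" "N > nat \<bar>n\<bar>"
    unfolding va_D_def using eventually_happens' sequentially_bot by blast
  \<comment> \<open>At the surviving index this coefficient is \<open>-n\<close> in the first half
    and \<open>n\<close> in the second, where the minus sign between the halves makes it
    \<open>-n\<close> as well.\<close>
  have c: "?c i = of_nat i + 1" for i
  proof -
    have "?c i = (1 + of_nat i) gchoose i"
      using gbinomial_minus[of "2::complex" i] by simp
    also have "\<dots> = of_nat (Suc i choose i)"
      by (simp only: binomial_gbinomial of_nat_Suc)
    finally show ?thesis by simp
  qed
  \<comment> \<open>For \<open>n = 0\<close> the selected index is 0, which is harmless because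
    \<open>?R\<close> is then zero.\<close>
  have "Y (D v) n w = (\<Sum>i<N. if i = (if n < 0 then nat (-1 - n) else nat (n - 1)) then ?R else 0)"
    unfolding N(1)
  proof (rule sum.cong)
    fix i
    show "scale (?c i) (Y v (-2 - int i) (Y vac (n + int i) w)
         - scale ((-1) powi (-2)) (Y vac (n + (-2) - int i) (Y v (int i) w)))
       = (if i = (if n < 0 then nat (-1 - n) else nat (n - 1)) then ?R else 0)"
    proof -
      consider "n < 0" "int i = -1 - n" | "n > 0" "int i = n - 1" | "n = 0" |
        "int i \<noteq> -1 - n" "int i \<noteq> n - 1" "n \<noteq> 0" by linarith
      then show ?thesis
      proof cases
        case 1
        then have "n = -1 - int i" by simp
        moreover have "Y v (-2 - int i) w = Y v (- int i - 2) w"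
          by (rule arg_cong[where f = "\<lambda>k. Y v k w"]) simp
        ultimately show ?thesis
          unfolding c by (simp add: vacuum add.commute flip: scale_minus_left)
      next
        case 2
        then have "n = int i + 1" by simp
        then show ?thesis unfolding c by (simp add: vacuum add.commute)
      next
        case 3
        then show ?thesis by (simp add: vacuum)
      next
        case 4
        then have "(if n < 0 then nat (-1 - n) else nat (n - 1)) \<noteq> i" by auto
        then show ?thesis using 4 by (auto simp: vacuum)
      qed
    qed
  qed simp
  also have "\<dots> = ?R"
    using N(2) by auto
  finally show ?thesis .
qed

text \<open>The iterate formula applied to the vacuum. Creation kills the whole second half, and in
  the first half everything but \<open>i = 0\<close>, which gives the term with \<open>D v\<close>,
  and \<open>i = 1\<close>, which gives the term with the mode \<open>n - 1\<close>.\<close>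

lemma D_Y: "D (Y u n v) = Y u n (D v) - scale (of_int n) (Y u (n - 1) v)"
proof -
  have "\<forall>\<^sub>F N in sequentially. Y (Y u n v) (-2) vac =
     (\<Sum>i<N. scale ((-1) ^ i * (of_int n gchoose i))
        (Y u (n - int i) (Y v (-2 + int i) vac)
         - scale ((-1) powi n) (Y v (-2 + n - int i) (Y u (int i) vac))))
      \<and> N \<ge> 2"
    by (intro eventually_conj iterate_formula eventually_ge_at_top)
  then obtain N where N: "Y (Y u n v) (-2) vac =
     (\<Sum>i<N. scale ((-1) ^ i * (of_int n gchoose i))
        (Y u (n - int i) (Y v (-2 + int i) vac)
         - scale ((-1) powi n) (Y v (-2 + n - int i) (Y u (int i) vac))))" "N \<ge> 2"
    using eventually_happens' sequentially_bot by blast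
  have "D (Y u n v) = (\<Sum>i<2. scale ((-1) ^ i * (of_int n gchoose i))
        (Y u (n - int i) (Y v (-2 + int i) vac)))"
    unfolding va_D_def N(1)
    by (rule sum.mono_neutral_cong_right) (use N(2) in \<open>auto simp: creation_nonneg\<close>)
  then show ?thesis
    by (simp add: numeral_2_eq_2 creation va_D_def)
qed

text \<open>These are the coefficients of \<open>Y(v,x)1 = exp(xD) v\<close>. Each induction step
  absorbs one mode shift into \<open>D v\<close> by \<open>D_mode\<close>, where the mode number
  \<open>-1 - i\<close> contributes the factor \<open>i + 1\<close>.\<close>

lemma mode_creation: "Y v (-1 - int i) vac = scale (1 / fact i) ((D ^^ i) v)"
proof (induction i arbitrary: v)
  case 0
  then show ?case by (simp add: creation)
next
  case (Suc i)
  have "scale (of_nat (Suc i)) (Y v (-1 - int (Suc i)) vac) = Y (D v) (-1 - int i) vac"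
  proof -
    have "-1 - int i - 1 = -1 - int (Suc i)" "- of_int (-1 - int i) = (of_nat (Suc i) :: complex)"
      by auto
    then show ?thesis by (simp only: D_mode scale_minus_left[symmetric])
  qed
  also have "\<dots> = scale (1 / fact i) ((D ^^ Suc i) v)"
    by (simp add: Suc funpow_swap1)
  finally have "scale (1 / of_nat (Suc i)) (scale (of_nat (Suc i)) (Y v (-1 - int (Suc i)) vac))
      = scale (1 / of_nat (Suc i)) (scale (1 / fact i) ((D ^^ Suc i) v))" by simp
  moreover have "1 / of_nat (Suc i) * of_nat (Suc i) = (1::complex)"
    by (simp del: of_nat_Suc)
  moreover have "1 / of_nat (Suc i) * (1 / fact i) = (1 / fact (Suc i) :: complex)"
    by (simp only: fact_Suc) (simp del: of_nat_Suc)
  ultimately show ?case by (simp only: scale_scale scale_one)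
qed

text \<open>The coefficients of \<open>Y(u,x)v = exp(xD) Y(v,-x)u\<close>. They come from the
  Borcherds identity for \<open>v\<close>, \<open>u\<close>, \<open>vac\<close> with
  \<open>m = -1\<close> and \<open>n = 0\<close>: creation collapses one side to a multiple of
  \<open>Y u l v\<close>, and \<open>mode_creation\<close> turns the other into powers of
  \<open>D\<close>.\<close>

lemma skew_symmetry:
  "\<forall>\<^sub>F N in sequentially. Y u l v =
     (\<Sum>i<N. scale ((-1) powi (l + int i + 1) * (1 / fact i)) ((D ^^ i) (Y v (l + int i) u)))"
proof -
  obtain N0 where N0: "\<And>i. i \<ge> N0 \<Longrightarrow> Y v (l + int i) u = 0"
    using eventually_mode_zero[of v l u] unfolding eventually_sequentially by blast
  have "Y u l v =
     (\<Sum>i<N. scale ((-1) powi (l + int i + 1) * (1 / fact i)) ((D ^^ i) (Y v (l + int i) u)))"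
    if "N \<ge> N0" for N
  proof -
    have gc: "(-1 gchoose i) = ((-1) ^ i :: complex)" for i
      using gbinomial_minus[of "1::complex" i] by (simp add: binomial_gbinomial[symmetric])
    have "Sum_any (\<lambda>i::nat. scale (of_int (-1) gchoose i) (Y (Y v (l + int i) u) (-1 + 0 - int i) vac))
        = (\<Sum>i<N. scale ((-1) ^ i * (1 / fact i)) ((D ^^ i) (Y v (l + int i) u)))"
      by (subst Sum_any_eq_sum_lessThan[where N = N])
        (use N0 that in \<open>auto simp: gc mode_creation\<close>)
    moreover have "Sum_any (\<lambda>i::nat. scale ((-1) ^ i * (of_int l gchoose i))
         (Y v (-1 + l - int i) (Y u (0 + int i) vac)
          - scale ((-1) powi l) (Y u (0 + l - int i) (Y v (-1 + int i) vac))))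
       = - scale ((-1) powi l) (Y u l v)"
      by (subst Sum_any_eq_sum_lessThan[where N = 1]) (auto simp: creation_nonneg creation)
    ultimately have "- scale ((-1) powi l) (Y u l v)
       = (\<Sum>i<N. scale ((-1) ^ i * (1 / fact i)) ((D ^^ i) (Y v (l + int i) u)))"
      using borcherds[of "-1" v l u 0 vac] by simp
    \<comment> \<open>The sign \<open>-(-1)^l\<close> is its own inverse, so multiplying by it
      isolates \<open>Y u l v\<close>.\<close>
    then have "scale (- ((-1) powi l)) (- scale ((-1) powi l) (Y u l v))
       = (\<Sum>i<N. scale (- ((-1) powi l) * ((-1) ^ i * (1 / fact i))) ((D ^^ i) (Y v (l + int i) u)))"
      by (simp add: scale_sum_right)
    moreover have "(-1::complex) powi l * (-1) powi l = 1"
      by (simp flip: power_int_add)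
    ultimately show ?thesis
      by (simp add: power_int_add)
  qed
  then show ?thesis unfolding eventually_sequentially by blast
qed

section \<open>The filtration and the degrees of modes\<close>

lemma subspace_E: "subspace (E n)"
  unfolding va_E_def by (rule subspace_span)

lemmas E_zero [simp] = subspace_0[OF subspace_E]
  and E_add = subspace_add[OF subspace_E]
  and E_diff = subspace_diff[OF subspace_E]
  and E_scale = subspace_scale[OF subspace_E]
  and E_sum = subspace_sum[OF subspace_E]
  and E_neg = subspace_neg[OF subspace_E]

lemma E_antimono: "m \<le> n \<Longrightarrow> E n \<subseteq> E m"
  unfolding va_E_def by (intro span_mono) force

lemma E_nonpos:
  assumes "n \<le> 0" shows "E n = UNIV"
proof -
  have "v \<in> E n" for v
    unfolding va_E_def
    \<comment> \<open>Generators need a nonempty list; the mode -1 of the vacuum acts as the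
      identity.\<close>
    by (rule span_base, rule CollectI, rule exI[of _ "[(vac, 0)]"])
      (use assms in \<open>auto simp: vacuum\<close>)
  then show ?thesis by auto
qed

lemma mode_neg_E:
  assumes "x \<in> E n" shows "Y u (-1 - int k) x \<in> E (n + int k)"
proof -
  have "E n \<subseteq> {x. Y u (-1 - int k) x \<in> E (n + int k)}"
    unfolding va_E_def[of _ _ n]
  proof (rule span_minimal)
    show "subspace {x. Y u (-1 - int k) x \<in> E (n + int k)}"
      by (rule subspaceI) (auto simp: Y_add_right Y_scale_right intro: E_add E_scale)
  next
    have "Y u (-1 - int k) (foldr (\<lambda>(u, k). Y u (-1 - int k)) us v) \<in> E (n + int k)"
      if "n \<le> int (sum_list (map snd us))" for us v
      unfolding va_E_def
      by (rule span_base, rule CollectI, rule exI[of _ "(u, k) # us"]) (use that in auto)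
    then show "{foldr (\<lambda>(u, k). Y u (-1 - int k)) us v | us v.
        us \<noteq> [] \<and> n \<le> int (sum_list (map snd us))} \<subseteq> {x. Y u (-1 - int k) x \<in> E (n + int k)}"
      by auto
  qed
  then show ?thesis using assms by auto
qed

text \<open>Induction along the list in a generator: dropping the outermost mode lowers the degree
  to be reached by \<open>k\<close>. The predicate therefore depends on the degree, and the case
  \<open>n \<le> 0\<close> absorbs the empty list, whose degree sum is 0.\<close>

lemma E_induct [consumes 1, case_names subspace base step]:
  assumes "x \<in> E n"
    and subspace: "\<And>n. subspace {x. P n x}"
    and base: "\<And>n x. n \<le> 0 \<Longrightarrow> P n x"
    and step: "\<And>n u k x. x \<in> E (n - int k) \<Longrightarrow> P (n - int k) x \<Longrightarrow> P n (Y u (-1 - int k) x)"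
  shows "P n x"
proof -
  have gen: "foldr (\<lambda>(u, k). Y u (-1 - int k)) us v \<in> E n \<and>
      P n (foldr (\<lambda>(u, k). Y u (-1 - int k)) us v)"
    if "n \<le> int (sum_list (map snd us))" for us v n
    using that
  proof (induction us arbitrary: n)
    case Nil
    then show ?case by (auto simp: E_nonpos base)
  next
    case (Cons p us)
    obtain u k where p: "p = (u, k)" by (cases p)
    let ?x = "foldr (\<lambda>(u, k). Y u (-1 - int k)) us v"
    have *: "?x \<in> E (n - int k) \<and> P (n - int k) ?x"
      using Cons.prems by (intro Cons.IH) (auto simp: p)
    then have "Y u (-1 - int k) ?x \<in> E (n - int k + int k)"
      by (intro mode_neg_E) auto
    then show ?case
      using step[of ?x n k u] * by (simp add: p)
  qed
  have "E n \<subseteq> {x. P n x}"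
    unfolding va_E_def by (rule span_minimal[OF _ subspace]) (use gen in auto)
  then show ?thesis using assms(1) by auto
qed

lemma mode_neg_E_le:
  assumes "x \<in> E s" "n < 0" "q \<le> s - n - 1"
  shows "Y u n x \<in> E q"
proof -
  have "Y u (-1 - int (nat (-1 - n))) x \<in> E (s + int (nat (-1 - n)))"
    by (rule mode_neg_E) fact
  then show ?thesis
    using E_antimono[OF assms(3)] assms(2) by (auto simp: algebra_simps)
qed

text \<open>By \<open>D_Y\<close>, \<open>D\<close> either moves past the outermost mode of a
  generator or lowers its mode number by one; both raise the degree by one. In the base case
  \<open>D x\<close> is the mode -2 of \<open>x\<close> applied to the vacuum, hence lies in
  \<open>E 1\<close>.\<close>

lemma D_E:
  assumes "x \<in> E n" shows "D x \<in> E (n + 1)"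
  using assms
proof (induction rule: E_induct)
  case (subspace n)
  then show ?case by (rule subspaceI) (auto simp: D_add D_scale intro: E_add E_scale)
next
  case (base n x)
  have "Y x (-2) vac \<in> E (n + 1)"
    by (rule mode_neg_E_le[of _ 0]) (use base in \<open>auto simp: E_nonpos\<close>)
  then show ?case by (simp add: va_D_def)
next
  case (step n u k x)
  have "Y u (-1 - int k) (D x) \<in> E (n + 1)" "Y u (-1 - int k - 1) x \<in> E (n + 1)"
    by (rule mode_neg_E_le[OF step(2)] mode_neg_E_le[OF step(1)]; simp)+
  then show ?case by (simp only: D_Y) (intro E_diff E_scale)
qed

lemma funpow_D_E: "x \<in> E n \<Longrightarrow> (D ^^ i) x \<in> E (n + int i)"
proof (induction i)
  case (Suc i)
  then show ?case using D_E[of "(D ^^ i) x" "n + int i"] by (simp add: add.assoc add.commute[of 1])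
qed simp

text \<open>The mode of \<open>u\<close> is commuted past the outermost mode of a generator. The
  correction terms are modes of \<open>Y u (int i) v\<close> on the shorter vector; negative ones
  are bounded by \<open>mode_neg_E_le\<close>, the others by the induction hypothesis, which must
  hold for all \<open>u\<close> and \<open>m\<close>.\<close>

lemma mode_nonneg_E:
  assumes "x \<in> E n"
  shows "Y u (int m) x \<in> E (n - int m)"
  using assms
proof (induction arbitrary: u m rule: E_induct)
  case (subspace n)
  then show ?case
    by (rule subspaceI) (auto simp: Y_add_right Y_scale_right intro: E_add E_scale)
next
  case (base n x)
  then show ?case by (simp add: E_nonpos)
next
  case (step n v k x)
  have "Y (Y u (int i) v) (int m + (-1 - int k) - int i) x \<in> E (n - int m)" if "i \<le> m" for i
  proof (cases "int m + (-1 - int k) - int i < 0")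
    case True
    then show ?thesis by (intro mode_neg_E_le[OF step(1)]) auto
  next
    case False
    then have "Y (Y u (int i) v) (int (nat (int m + (-1 - int k) - int i))) x
        \<in> E (n - int k - int (nat (int m + (-1 - int k) - int i)))"
      by (intro step(2))
    moreover have "E (n - int k - int (nat (int m + (-1 - int k) - int i))) \<subseteq> E (n - int m)"
      using False by (intro E_antimono) auto
    ultimately show ?thesis using False by auto
  qed
  then have "(\<Sum>i\<le>m. scale (of_nat (m choose i)) (Y (Y u (int i) v) (int m + (-1 - int k) - int i) x))
      \<in> E (n - int m)"
    by (intro E_sum E_scale) auto
  moreover have "Y v (-1 - int k) (Y u (int m) x) \<in> E (n - int m)"
    using step(2) by (rule mode_neg_E_le) auto
  ultimately show ?case
    using commutator_formula[of u m v "-1 - int k" x] E_add by (metis diff_add_cancel)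
qed

lemma mode_nonneg_E_le:
  assumes "x \<in> E s" "n \<ge> 0" "q \<le> s - n"
  shows "Y u n x \<in> E q"
  using mode_nonneg_E[OF assms(1), of u "nat n"] E_antimono[OF assms(3)] assms(2) by auto

text \<open>The degree estimate behind everything that follows: nonnegative modes do better by one
  than negative ones. Induction runs over the generators of \<open>E r\<close>, with the iterate
  formula expanding the outermost mode of \<open>u\<close>. A free target \<open>q\<close> lets both
  bounds travel through one induction.\<close>

lemma mode_E:
  assumes "u \<in> E r" "x \<in> E s" "q \<le> r + s - n" "n < 0 \<Longrightarrow> q \<le> r + s - n - 1"
  shows "Y u n x \<in> E q"
  using assms
proof (induction arbitrary: x s n q rule: E_induct)
  case (subspace r)
  then show ?case
    by (rule subspaceI) (auto simp: Y_add_left Y_scale_left intro!: E_add E_scale)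
next
  case (base r u)
  then show ?case
    using mode_neg_E_le[of x s n q u] mode_nonneg_E_le[of x s n q u] by force
next
  case (step r u k v)
  have "Y u (-1 - int k - int i) (Y v (n + int i) x) \<in> E q" for i
  proof (rule mode_neg_E_le)
    \<comment> \<open>If \<open>n + int i < 0\<close> then also \<open>n < 0\<close>, so the
      stricter bound on \<open>q\<close> is available exactly when it is required.\<close>
    show "Y v (n + int i) x \<in> E (q - int k - int i)"
      by (rule step(2)[OF step(3)]) (use step(4,5) in linarith)+
  qed auto
  moreover have "Y v (n + (-1 - int k) - int i) (Y u (int i) x) \<in> E q" for i
  proof (rule step(2))
    show "Y u (int i) x \<in> E (s - int i)" using step(3) by (rule mode_nonneg_E)
  qed (use step(4,5) in linarith)+
  moreover obtain N where "Y (Y u (-1 - int k) v) n x =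
     (\<Sum>i<N. scale ((-1) ^ i * (of_int (-1 - int k) gchoose i))
        (Y u (-1 - int k - int i) (Y v (n + int i) x)
         - scale ((-1) powi (-1 - int k)) (Y v (n + (-1 - int k) - int i) (Y u (int i) x))))"
    using iterate_formula eventually_happens' sequentially_bot by blast
  ultimately show ?case
    by (simp only:) (intro E_sum E_scale E_diff; blast)
qed

section \<open>Commutativity, associativity and Leibniz rule modulo higher degree\<close>

lemma mult_commute_E:
  assumes "a \<in> E r" "b \<in> E s"
  shows "Y a (-1) b - Y b (-1) a \<in> E (r + s + 1)"
proof -
  have "\<forall>\<^sub>F N in sequentially. Y a (-1) b =
     (\<Sum>i<N. scale ((-1) powi (-1 + int i + 1) * (1 / fact i)) ((D ^^ i) (Y b (-1 + int i) a))) \<and> N > 0"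
    by (intro eventually_conj skew_symmetry eventually_gt_at_top)
  then obtain N where N: "Y a (-1) b =
     (\<Sum>i<N. scale ((-1) powi (-1 + int i + 1) * (1 / fact i)) ((D ^^ i) (Y b (-1 + int i) a)))" "N > 0"
    using eventually_happens' sequentially_bot by blast
  then obtain M where M: "N = Suc M" using gr0_conv_Suc by blast
  \<comment> \<open>Beyond the leading summand of skew symmetry the modes of \<open>b\<close> are
    nonnegative: mode \<open>i\<close> costs \<open>i\<close> degrees, while the
    \<open>i + 1\<close> copies of \<open>D\<close> gain \<open>i + 1\<close>.\<close>
  have *: "(D ^^ Suc i) (Y b (-1 + int (Suc i)) a) \<in> E (r + s + 1)" for i
  proof -
    have "Y b (int i) a \<in> E (r + s - int i)"
      by (rule mode_E[OF assms(2,1)]) auto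
    from funpow_D_E[OF this, of "Suc i"] show ?thesis by (simp add: algebra_simps)
  qed
  have "Y a (-1) b - Y b (-1) a = (\<Sum>i<M. scale ((-1) powi (-1 + int (Suc i) + 1) * (1 / fact (Suc i)))
      ((D ^^ Suc i) (Y b (-1 + int (Suc i)) a)))"
    unfolding N(1) M sum.lessThan_Suc_shift by simp
  then show ?thesis
    by (simp only:) (intro E_sum E_scale *)
qed

text \<open>The iterate formula with both modes equal to -1. Its leading summand contains
  \<open>Y a (-1) (Y b (-1) c)\<close>; every remaining term contains exactly one nonnegative mode,
  and \<open>mode_E\<close> gains one degree from it.\<close>

lemma mult_assoc_E:
  assumes "a \<in> E r" "b \<in> E s" "c \<in> E t"
  shows "Y (Y a (-1) b) (-1) c - Y a (-1) (Y b (-1) c) \<in> E (r + s + t + 1)"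
proof -
  let ?f = "\<lambda>i. scale ((-1) ^ i * (of_int (-1) gchoose i))
        (Y a (-1 - int i) (Y b (-1 + int i) c)
         - scale ((-1) powi (-1)) (Y b (-1 + -1 - int i) (Y a (int i) c)))"
  have "\<forall>\<^sub>F N in sequentially. Y (Y a (-1) b) (-1) c = sum ?f {..<N} \<and> N > 0"
    by (intro eventually_conj iterate_formula eventually_gt_at_top)
  then obtain N where N: "Y (Y a (-1) b) (-1) c = sum ?f {..<N}" "N > 0"
    using eventually_happens' sequentially_bot by blast
  then obtain M where M: "N = Suc M" using gr0_conv_Suc by blast
  have "Y (Y a (-1) b) (-1) c - Y a (-1) (Y b (-1) c)
      = Y b (-2) (Y a 0 c) + (\<Sum>i<M. ?f (Suc i))"
    unfolding N(1) M sum.lessThan_Suc_shift by simp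
  moreover have 2: "Y b (-1 + -1 - int i) (Y a (int i) c) \<in> E (r + s + t + 1)" for i
    by (rule mode_E[OF assms(2), where s = "r + t - int i"], rule mode_E[OF assms(1,3)]) auto
  moreover have "Y a (-1 - int (Suc i)) (Y b (-1 + int (Suc i)) c) \<in> E (r + s + t + 1)" for i
    by (rule mode_E[OF assms(1), where s = "s + t - int i"], rule mode_E[OF assms(2,3)]) auto
  moreover have "Y b (-2) (Y a 0 c) \<in> E (r + s + t + 1)"
    using 2[of 0] by simp
  ultimately show ?thesis
    by (simp only:) (intro E_add E_sum E_scale E_diff; assumption)
qed

text \<open>In the commutator formula the summand \<open>i = n\<close> is the expected product. For
  \<open>i < n\<close> both modes are nonnegative instead of only one, which gains the additional
  degree.\<close>

lemma mode_derivation_E: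
  assumes "a \<in> E r" "b \<in> E s" "c \<in> E t"
  shows "Y a (int n) (Y b (-1) c) - (Y (Y a (int n) b) (-1) c + Y b (-1) (Y a (int n) c))
    \<in> E (r + s + t - int n + 1)"
proof -
  have "Y a (int n) (Y b (-1) c) - (Y (Y a (int n) b) (-1) c + Y b (-1) (Y a (int n) c))
     = (\<Sum>i<n. scale (of_nat (n choose i)) (Y (Y a (int i) b) (int n + (-1) - int i) c))"
    using commutator_formula[of a n b "-1" c]
    by (simp add: lessThan_Suc_atMost[symmetric] algebra_simps)
  moreover have "Y (Y a (int i) b) (int n + (-1) - int i) c \<in> E (r + s + t - int n + 1)"
    if "i < n" for i
    by (rule mode_E[OF mode_E[OF assms(1,2), where q = "r + s - int i"] assms(3)]) (use that in auto)
  ultimately show ?thesis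
    by (simp only:) (intro E_sum E_scale; force)
qed

lemma D_derivation: "D (Y a (-1) b) = Y (D a) (-1) b + Y a (-1) (D b)"
  by (simp add: D_Y D_mode)

end

section \<open>Linear endomorphisms of modules\<close>

lemma complex_ring_simps [simp]:
  "carrier complex_ring = UNIV" "\<zero>\<^bsub>complex_ring\<^esub> = 0" "\<one>\<^bsub>complex_ring\<^esub> = 1"
  "x \<oplus>\<^bsub>complex_ring\<^esub> y = x + y" "x \<otimes>\<^bsub>complex_ring\<^esub> y = x * y"
  by (simp_all add: ring_of_type_algebra_def)

lemma linear_endo_closed: "linear_endo R M f \<Longrightarrow> x \<in> carrier M \<Longrightarrow> f x \<in> carrier M"
  by (auto simp: linear_endo_def)

lemma linear_endo_comp:
  "linear_endo R M f \<Longrightarrow> linear_endo R M g \<Longrightarrow> linear_endo R M (\<lambda>x. f (g x))"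
  by (auto simp: linear_endo_def Pi_iff)

lemma linear_endo_id: "linear_endo R M (\<lambda>x. x)"
  by (auto simp: linear_endo_def)

lemma linear_endo_funpow: "linear_endo R M f \<Longrightarrow> linear_endo R M (f ^^ i)"
proof (induction i)
  case 0
  show ?case using linear_endo_id by (simp add: id_def)
next
  case (Suc i)
  then show ?case using linear_endo_comp[of R M f "f ^^ i"] by (simp add: comp_def)
qed

context module
begin

lemma linear_endo_zero: "linear_endo R M (\<lambda>x. \<zero>\<^bsub>M\<^esub>)"
  by (auto simp: linear_endo_def)

lemma linear_endo_add:
  assumes "linear_endo R M f" "linear_endo R M g"
  shows "linear_endo R M (\<lambda>x. f x \<oplus>\<^bsub>M\<^esub> g x)"
  using assms by (auto simp: linear_endo_def Pi_iff M.a_ac smult_r_distr)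

lemma linear_endo_smult:
  assumes "c \<in> carrier R" "linear_endo R M f"
  shows "linear_endo R M (\<lambda>x. c \<odot>\<^bsub>M\<^esub> f x)"
  using assms
  by (auto simp: linear_endo_def Pi_iff smult_r_distr smult_assoc1[symmetric] R.m_comm)

lemma linear_endo_uminus:
  assumes "linear_endo R M f"
  shows "linear_endo R M (\<lambda>x. \<ominus>\<^bsub>M\<^esub> f x)"
  using assms by (auto simp: linear_endo_def Pi_iff M.minus_add smult_r_minus)

lemma linear_endo_minus:
  assumes "linear_endo R M f" "linear_endo R M g"
  shows "linear_endo R M (\<lambda>x. f x \<ominus>\<^bsub>M\<^esub> g x)"
  unfolding a_minus_def by (intro linear_endo_add linear_endo_uminus assms)

lemma linear_endo_cong:
  assumes "linear_endo R M g" "\<And>x. x \<in> carrier M \<Longrightarrow> f x = g x"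
  shows "linear_endo R M f"
  using assms by (auto simp: linear_endo_def Pi_iff)

lemma linear_endo_finsum:
  assumes "\<And>i. i \<in> I \<Longrightarrow> linear_endo R M (f i)" and "finite I"
  shows "linear_endo R M (\<lambda>x. \<Oplus>\<^bsub>M\<^esub>i\<in>I. f i x)"
  using assms(2,1)
proof (induction I)
  case empty
  then show ?case by (simp add: linear_endo_zero)
next
  case (insert i I)
  have "linear_endo R M (\<lambda>x. f i x \<oplus>\<^bsub>M\<^esub> (\<Oplus>\<^bsub>M\<^esub>i\<in>I. f i x))"
    using insert by (intro linear_endo_add) auto
  moreover have "(\<Oplus>\<^bsub>M\<^esub>i\<in>insert i I. f i x) = f i x \<oplus>\<^bsub>M\<^esub> (\<Oplus>\<^bsub>M\<^esub>i\<in>I. f i x)"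
    if "x \<in> carrier M" for x
    using insert that by (intro M.finsum_insert) (auto intro: linear_endo_closed)
  ultimately show ?case by (rule linear_endo_cong)
qed

end

section \<open>The associated graded algebra\<close>

context vertex_algebra
begin

abbreviation G :: "(complex, nat \<Rightarrow> 'v set) module" where "G \<equiv> gr scale vac Y"
abbreviation elt :: "int \<Rightarrow> 'v \<Rightarrow> nat \<Rightarrow> 'v set" where "elt \<equiv> gr_elt scale Y"

text \<open>Finitely supported families of representatives. Computing through them replaces
  Minkowski operations on cosets by pointwise operations in the vertex algebra.\<close>

definition gr_reps :: "(nat \<Rightarrow> 'v) set" where
  "gr_reps = {a. (\<forall>k. a k \<in> E (int k)) \<and> finite {k. a k \<noteq> 0}}"

definition gr_class :: "(nat \<Rightarrow> 'v) \<Rightarrow> nat \<Rightarrow> 'v set" where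
  "gr_class a = (\<lambda>k. a k +o E (int k + 1))"

text \<open>The common form of the multiplication (\<open>N = -1\<close>) and of the modes (\<open>N \<ge> 0\<close>);
  the shift \<open>nat N\<close> of the degree is \<open>0\<close> for \<open>N = -1\<close>.\<close>

definition gr_mode :: "int \<Rightarrow> (nat \<Rightarrow> 'v set) \<Rightarrow> (nat \<Rightarrow> 'v set) \<Rightarrow> nat \<Rightarrow> 'v set" where
  "gr_mode N f g k = (\<Sum>r\<le>k + nat N. coset_prod scale Y N k (f r) (g (k + nat N - r)))"

lemma gr_mult_eq: "f \<otimes>\<^bsub>G\<^esub> g = gr_mode (-1) f g"
  by (simp add: gr_def gr_mode_def fun_eq_iff)

lemma gr_Ym_eq: "gr_Ym scale Y f n g = gr_mode (int n) f g"
  by (simp add: gr_Ym_def gr_mode_def fun_eq_iff)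

section \<open>Cosets and operations on representatives\<close>

lemma E_plus_E: "E n + E n = E n"
  using set_zero_plus2[of "E n" "E n"] by (auto simp: set_plus_def intro: E_add)

lemma coset_eq_iff: "a +o E n = b +o E n \<longleftrightarrow> a - b \<in> E n"
proof
  assume "a +o E n = b +o E n"
  then have "a \<in> b +o E n" using set_plus_intro2[of 0 "E n" a] by simp
  then show "a - b \<in> E n" by (rule set_plus_imp_minus)
next
  assume *: "a - b \<in> E n"
  have "c - a \<in> E n \<longleftrightarrow> c - b \<in> E n" for c
    using E_add[OF *, of "c - a"] E_diff[OF _ *, of "c - b"] by auto
  then show "a +o E n = b +o E n"
    by (auto simp: set_minus_plus[symmetric])
qed

lemma coset_add: "(a +o E n) + (b +o E n) = (a + b) +o E n"
  by (simp add: set_plus_rearrange E_plus_E)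

text \<open>The index set must be nonempty because the empty Minkowski sum is the set containing
  only 0, not \<open>E n\<close>.\<close>

lemma coset_sum:
  "finite S \<Longrightarrow> S \<noteq> {} \<Longrightarrow> (\<Sum>i\<in>S. f i +o E n) = sum f S +o E n"
  by (induction S rule: finite_ne_induct) (auto simp: coset_add)

text \<open>The image of a coset may be smaller than a coset, for instance a single point under
  scaling by 0; the added \<open>E n\<close> fills it up.\<close>

lemma image_coset:
  assumes add: "\<And>x y. f (x + y) = f x + f y" and E: "f ` E m \<subseteq> E n"
  shows "f ` (a +o E m) + E n = f a +o E n"
proof
  show "f ` (a +o E m) + E n \<subseteq> f a +o E n"
  proof
    fix z assume "z \<in> f ` (a +o E m) + E n"
    then obtain x y where "x \<in> E m" "y \<in> E n" "z = f (a + x) + y"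
      by (auto simp: set_plus_def elt_set_plus_def)
    moreover from this have "f x + y \<in> E n" using E by (intro E_add) auto
    ultimately show "z \<in> f a +o E n" by (auto simp: add add.assoc)
  qed
  show "f a +o E n \<subseteq> f ` (a +o E m) + E n"
    by (rule set_plus_mono3) (use set_plus_intro2[of 0 "E m" a] in auto)
qed

text \<open>Independence of representatives. When both factors are changed by elements one degree
  deeper, each of the three new terms of the expanded product lies in \<open>E (int k + 1)\<close>
  by \<open>mode_E\<close>.\<close>

lemma coset_prod_eq:
  assumes "a \<in> E r" "b \<in> E s" "int k \<le> r + s - n" "n < 0 \<Longrightarrow> int k \<le> r + s - n - 1"
  shows "coset_prod scale Y n k (a +o E (r + 1)) (b +o E (s + 1)) = Y a n b +o E (int k + 1)"
proof
  show "coset_prod scale Y n k (a +o E (r + 1)) (b +o E (s + 1)) \<subseteq> Y a n b +o E (int k + 1)"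
  proof
    fix z assume "z \<in> coset_prod scale Y n k (a +o E (r + 1)) (b +o E (s + 1))"
    then obtain x y w where xy: "x \<in> E (r + 1)" "y \<in> E (s + 1)" "w \<in> E (int k + 1)"
      "z = Y (a + x) n (b + y) + w"
      by (auto simp: coset_prod_def set_plus_def elt_set_plus_def)
    have "Y a n y \<in> E (int k + 1)"
      by (rule mode_E[OF assms(1) xy(2)]) (use assms(3,4) in auto)
    moreover have "Y x n b \<in> E (int k + 1)"
      by (rule mode_E[OF xy(1) assms(2)]) (use assms(3,4) in auto)
    moreover have "Y x n y \<in> E (int k + 1)"
      by (rule mode_E[OF xy(1,2)]) (use assms(3,4) in auto)
    ultimately have "Y a n y + Y x n b + Y x n y + w \<in> E (int k + 1)"
      using xy(3) by (intro E_add)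
    moreover have "z = Y a n b + (Y a n y + Y x n b + Y x n y + w)"
      by (simp add: xy(4) Y_add_left Y_add_right add_ac)
    ultimately show "z \<in> Y a n b +o E (int k + 1)" by auto
  qed
  have "a \<in> a +o E (r + 1)" "b \<in> b +o E (s + 1)"
    using set_plus_intro2[of 0 "E (r + 1)" a] set_plus_intro2[of 0 "E (s + 1)" b] by auto
  then show "Y a n b +o E (int k + 1) \<subseteq> coset_prod scale Y n k (a +o E (r + 1)) (b +o E (s + 1))"
    unfolding coset_prod_def by (intro set_plus_mono3) auto
qed

lemma gr_class_eq_iff: "gr_class a = gr_class b \<longleftrightarrow> (\<forall>k. a k - b k \<in> E (int k + 1))"
  by (simp add: gr_class_def fun_eq_iff coset_eq_iff)

lemma elt_eq_class: "elt d a = gr_class (\<lambda>k. if int k = d then a else 0)"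
  by (auto simp: gr_elt_def gr_class_def fun_eq_iff)

lemma carrier_gr: "carrier G = gr_class ` gr_reps"
proof
  show "carrier G \<subseteq> gr_class ` gr_reps"
  proof
    fix f assume "f \<in> carrier G"
    then have f: "\<exists>a\<in>E (int n). f n = a +o E (int n + 1)"
      and fin: "finite {n. f n \<noteq> E (int n + 1)}" for n
      by (auto simp: gr_def gr_carrier_def)
    from f obtain a where a: "\<And>n. a n \<in> E (int n)" "\<And>n. f n = a n +o E (int n + 1)" by metis
    \<comment> \<open>A chosen representative of the zero coset may be a nonzero element of
      \<open>E (int n + 1)\<close>; replacing it by 0 makes the support finite.\<close>
    define b where "b n = (if f n = E (int n + 1) then 0 else a n)" for n
    have "b \<in> gr_reps"
      unfolding gr_reps_def b_def using a(1) by (auto intro: finite_subset[OF _ fin])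
    moreover have "f = gr_class b"
      unfolding gr_class_def b_def by (rule ext) (use a(2) in auto)
    ultimately show "f \<in> gr_class ` gr_reps" by auto
  qed
next
  have "finite {k. gr_class a k \<noteq> E (int k + 1)}" if "finite {k. a k \<noteq> 0}" for a
    by (rule finite_subset[OF _ that]) (auto simp: gr_class_def)
  then show "gr_class ` gr_reps \<subseteq> carrier G"
    by (auto simp: gr_def gr_carrier_def gr_reps_def) (auto simp: gr_class_def)
qed

lemma gr_zero: "\<zero>\<^bsub>G\<^esub> = gr_class (\<lambda>k. 0)"
  by (simp add: gr_def gr_class_def)

lemma gr_one: "\<one>\<^bsub>G\<^esub> = elt 0 vac"
  by (simp add: gr_def)

lemma gr_add: "gr_class a \<oplus>\<^bsub>G\<^esub> gr_class b = gr_class (\<lambda>k. a k + b k)"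
  by (simp add: gr_def gr_class_def coset_add)

lemma gr_smult: "c \<odot>\<^bsub>G\<^esub> gr_class a = gr_class (\<lambda>k. scale c (a k))"
  by (auto simp: gr_def gr_class_def fun_eq_iff image_coset scale_right_distrib E_scale image_subset_iff)

lemma gr_D_class: "gr_D scale vac Y (gr_class a) = gr_class (\<lambda>k. if k = 0 then 0 else D (a (k - 1)))"
proof
  fix k
  show "gr_D scale vac Y (gr_class a) k = gr_class (\<lambda>k. if k = 0 then 0 else D (a (k - 1))) k"
  proof (cases k)
    case 0
    then show ?thesis by (simp add: gr_D_def gr_class_def)
  next
    case (Suc j)
    have "D ` (a j +o E (int j + 1)) + E (int j + 2) = D (a j) +o E (int j + 2)"
      using D_E[of _ "int j + 1"] by (intro image_coset) (auto simp: D_add add.assoc)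
    then show ?thesis by (simp add: gr_D_def gr_class_def Suc add.commute)
  qed
qed

lemma gr_mode_class:
  assumes "a \<in> gr_reps" "b \<in> gr_reps" "N \<ge> -1"
  shows "gr_mode N (gr_class a) (gr_class b) = gr_class (\<lambda>k. \<Sum>r\<le>k + nat N. Y (a r) N (b (k + nat N - r)))"
proof
  fix k
  have "coset_prod scale Y N k (gr_class a r) (gr_class b (k + nat N - r))
      = Y (a r) N (b (k + nat N - r)) +o E (int k + 1)" if "r \<le> k + nat N" for r
    unfolding gr_class_def
    by (rule coset_prod_eq[where r = "int r" and s = "int (k + nat N - r)"])
      (use assms that in \<open>auto simp: gr_reps_def simp del: of_nat_diff\<close>)
  then show "gr_mode N (gr_class a) (gr_class b) k
      = gr_class (\<lambda>k. \<Sum>r\<le>k + nat N. Y (a r) N (b (k + nat N - r))) k"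
    by (simp add: gr_mode_def gr_class_def coset_sum)
qed

lemma gr_reps_bound:
  assumes "a \<in> gr_reps" obtains A where "\<And>k. k > A \<Longrightarrow> a k = 0"
proof -
  have "finite {k. a k \<noteq> 0}" using assms by (simp add: gr_reps_def)
  then obtain A where "\<forall>k\<in>{k. a k \<noteq> 0}. k \<le> A" using finite_nat_set_iff_bounded_le by blast
  then have "a k = 0" if "k > A" for k using that by (meson leD mem_Collect_eq)
  then show ?thesis by (rule that)
qed

lemma gr_repsI:
  assumes "\<And>k. a k \<in> E (int k)" "\<And>k. k > A \<Longrightarrow> a k = 0"
  shows "a \<in> gr_reps"
proof -
  have "{k. a k \<noteq> 0} \<subseteq> {..A}" using assms(2) not_less by auto
  then show ?thesis using assms(1) finite_subset by (auto simp: gr_reps_def)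
qed

lemma gr_reps_E: "a \<in> gr_reps \<Longrightarrow> a k \<in> E (int k)"
  by (simp add: gr_reps_def)

lemma gr_reps_zero: "(\<lambda>k. 0) \<in> gr_reps"
  by (simp add: gr_reps_def)

lemma gr_reps_single: "a \<in> E d \<Longrightarrow> (\<lambda>k. if int k = d then a else 0) \<in> gr_reps"
  by (rule gr_repsI[where A = "nat d"]) auto

lemma gr_reps_add:
  assumes "a \<in> gr_reps" "b \<in> gr_reps" shows "(\<lambda>k. a k + b k) \<in> gr_reps"
proof -
  obtain A B where "\<And>k. k > A \<Longrightarrow> a k = 0" "\<And>k. k > B \<Longrightarrow> b k = 0"
    using assms gr_reps_bound by metis
  then show ?thesis
    by (intro gr_repsI[where A = "max A B"]) (auto intro: E_add gr_reps_E assms)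
qed

lemma gr_reps_scale:
  assumes "a \<in> gr_reps" shows "(\<lambda>k. scale c (a k)) \<in> gr_reps"
proof -
  obtain A where "\<And>k. k > A \<Longrightarrow> a k = 0" using assms gr_reps_bound by metis
  then show ?thesis by (intro gr_repsI[where A = A]) (auto intro: E_scale gr_reps_E assms)
qed

lemma gr_reps_D:
  assumes "a \<in> gr_reps" shows "(\<lambda>k. if k = 0 then 0 else D (a (k - 1))) \<in> gr_reps"
proof -
  obtain A where A: "\<And>k. k > A \<Longrightarrow> a k = 0" using assms gr_reps_bound by metis
  have "D (a (k - 1)) \<in> E (int k)" if "k \<noteq> 0" for k
    using D_E[OF gr_reps_E[OF assms, of "k - 1"]] that by (simp add: of_nat_diff)
  with A show ?thesis by (intro gr_repsI[where A = "Suc A"]) auto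
qed

lemma gr_reps_mode:
  assumes "a \<in> gr_reps" "b \<in> gr_reps" "N \<ge> -1"
  shows "(\<lambda>k. \<Sum>r\<le>k + nat N. Y (a r) N (b (k + nat N - r))) \<in> gr_reps"
proof -
  obtain A B where AB: "\<And>k. k > A \<Longrightarrow> a k = 0" "\<And>k. k > B \<Longrightarrow> b k = 0"
    using assms gr_reps_bound by metis
  show ?thesis
  proof (rule gr_repsI[where A = "A + B"])
    fix k
    have "Y (a r) N (b (k + nat N - r)) \<in> E (int k)" if "r \<le> k + nat N" for r
      by (rule mode_E[OF gr_reps_E[OF assms(1)] gr_reps_E[OF assms(2)]])
        (use that assms(3) in auto)
    then show "(\<Sum>r\<le>k + nat N. Y (a r) N (b (k + nat N - r))) \<in> E (int k)"
      by (intro E_sum) auto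
  next
    fix k assume k: "k > A + B"
    have "Y (a r) N (b (k + nat N - r)) = 0" for r
    proof (cases "r > A")
      case False
      then have "b (k + nat N - r) = 0" using k by (intro AB) auto
      then show ?thesis by simp
    qed (simp add: AB)
    then show "(\<Sum>r\<le>k + nat N. Y (a r) N (b (k + nat N - r))) = 0" by simp
  qed
qed

lemma gr_carrierE:
  assumes "x \<in> carrier G" obtains a where "a \<in> gr_reps" "x = gr_class a"
  using assms by (auto simp: carrier_gr)

lemma gr_class_closed [simp]: "a \<in> gr_reps \<Longrightarrow> gr_class a \<in> carrier G"
  by (simp add: carrier_gr)

section \<open>The graded module and its homogeneous elements\<close>

lemma gr_module: "module complex_ring G"
proof (rule moduleI)
  show "cring complex_ring" by (rule cring_from_type_algebra)
  show "abelian_group G"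
  proof (rule abelian_groupI)
    fix x assume "x \<in> carrier G"
    then obtain a where a: "a \<in> gr_reps" "x = gr_class a" by (rule gr_carrierE)
    then have "gr_class (\<lambda>k. scale (-1) (a k)) \<in> carrier G"
      "gr_class (\<lambda>k. scale (-1) (a k)) \<oplus>\<^bsub>G\<^esub> x = \<zero>\<^bsub>G\<^esub>"
      by (simp_all only: gr_class_closed gr_reps_scale gr_add gr_zero) (simp add: gr_zero)
    then show "\<exists>y\<in>carrier G. y \<oplus>\<^bsub>G\<^esub> x = \<zero>\<^bsub>G\<^esub>" by blast
  qed (auto elim!: gr_carrierE simp: gr_add gr_zero gr_reps_add gr_reps_zero add_ac)
qed (auto elim!: gr_carrierE
  simp: gr_add gr_smult gr_reps_scale scale_left_distrib scale_right_distrib)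

interpretation gr: module complex_ring G by (rule gr_module)

lemma elt_closed: "a \<in> E d \<Longrightarrow> elt d a \<in> carrier G"
  by (simp add: elt_eq_class gr_reps_single)

lemma elt_add: "elt d a \<oplus>\<^bsub>G\<^esub> elt d b = elt d (a + b)"
  by (auto simp: elt_eq_class gr_add intro!: arg_cong[where f = gr_class])

lemma elt_smult: "c \<odot>\<^bsub>G\<^esub> elt d a = elt d (scale c a)"
  by (auto simp: elt_eq_class gr_smult intro!: arg_cong[where f = gr_class])

lemma elt_eqI: "a - b \<in> E (d + 1) \<Longrightarrow> elt d a = elt d b"
  by (auto simp: elt_eq_class gr_class_eq_iff)

lemma elt_eq_zero: "a \<in> E (d + 1) \<Longrightarrow> elt d a = \<zero>\<^bsub>G\<^esub>"
  by (auto simp: elt_eq_class gr_zero gr_class_eq_iff)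

lemma elt_sum:
  assumes "finite I" "\<And>i. i \<in> I \<Longrightarrow> f i \<in> E d"
  shows "(\<Oplus>\<^bsub>G\<^esub>i\<in>I. elt d (f i)) = elt d (sum f I)"
  using assms
proof (induction I)
  case empty
  then show ?case by (simp add: elt_eq_zero)
next
  case (insert i I)
  then show ?case by (subst gr.finsum_insert) (auto simp: elt_add intro: elt_closed)
qed

lemma elt_minus:
  assumes "a \<in> E d" "b \<in> E d"
  shows "elt d a \<ominus>\<^bsub>G\<^esub> elt d b = elt d (a - b)"
proof -
  have "elt d a = elt d (a - b) \<oplus>\<^bsub>G\<^esub> elt d b" by (simp add: elt_add)
  then show ?thesis
    using assms E_diff elt_closed by (simp add: gr.minus_eq gr.M.a_assoc gr.M.r_neg)
qed

lemma gr_D_elt: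
  assumes "a \<in> E d"
  shows "gr_D scale vac Y (elt d a) = elt (d + 1) (D a)"
proof (cases "d < 0")
  case True
  \<comment> \<open>For \<open>d = -1\<close> the image sits in degree 0 and is not zero for degree
    reasons. It vanishes because \<open>a\<close> also lies in \<open>E (d + 1)\<close>, which is
    the whole space.\<close>
  then have "D a \<in> E (d + 1 + 1)" by (intro D_E) (simp add: E_nonpos)
  with True show ?thesis
    by (simp add: elt_eq_zero) (auto simp: elt_eq_class gr_D_class gr_zero gr_class_eq_iff)
next
  case False
  then show ?thesis
    by (auto simp: elt_eq_class gr_D_class intro!: arg_cong[where f = gr_class])
qed

lemma gr_mode_elt:
  assumes a: "a \<in> E r" and b: "b \<in> E s" and N: "N \<ge> -1"
  shows "gr_mode N (elt r a) (elt s b) = elt (r + s - int (nat N)) (Y a N b)"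
proof -
  let ?a = "\<lambda>k. if int k = r then a else 0" and ?b = "\<lambda>k. if int k = s then b else 0"
  let ?c = "\<lambda>k. \<Sum>q\<le>k + nat N. Y (?a q) N (?b (k + nat N - q))"
  have "?c k - (if int k = r + s - int (nat N) then Y a N b else 0) \<in> E (int k + 1)" for k
  proof (cases "int k = r + s - int (nat N) \<and> r \<ge> 0 \<and> s \<ge> 0")
    case True
    have "?c k = (\<Sum>q\<in>{nat r}. Y (?a q) N (?b (k + nat N - q)))"
      by (rule sum.mono_neutral_right) (use True in \<open>auto simp: nat_le_iff\<close>)
    also have "\<dots> = Y a N b"
    proof -
      have "k + nat N - nat r = nat s" using True by linarith
      then show ?thesis using True by simp
    qed
    finally show ?thesis using True by simp
  next
    case False
    have "?c k = 0"
      by (rule sum.neutral) (use False in \<open>auto simp: of_nat_diff\<close>)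
    moreover have "Y a N b \<in> E (int k + 1)" if k: "int k = r + s - int (nat N)"
    proof (cases "r < 0")
      case True
      then have "a \<in> E (r + 1)" by (simp add: E_nonpos)
      then show ?thesis by (rule mode_E[OF _ b]) (use k N in auto)
    next
      case r: False
      then have "b \<in> E (s + 1)" using False k by (simp add: E_nonpos)
      then show ?thesis by (rule mode_E[OF a]) (use k N in auto)
    qed
    ultimately show ?thesis by (auto intro: E_neg)
  qed
  then have "gr_class ?c = elt (r + s - int (nat N)) (Y a N b)"
    unfolding elt_eq_class gr_class_eq_iff by blast
  then show ?thesis
    using gr_mode_class[OF gr_reps_single[OF a] gr_reps_single[OF b] N] by (simp only: elt_eq_class)
qed

text \<open>Splits off one homogeneous component at a time, by induction on a finite set containing
  the support of a representing family.\<close>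

lemma gr_induct [consumes 1, case_names elt add]:
  assumes "x \<in> carrier G"
    and elt: "\<And>d a. a \<in> E d \<Longrightarrow> P (elt d a)"
    and add: "\<And>x y. x \<in> carrier G \<Longrightarrow> y \<in> carrier G \<Longrightarrow> P x \<Longrightarrow> P y \<Longrightarrow> P (x \<oplus>\<^bsub>G\<^esub> y)"
  shows "P x"
proof -
  obtain a where a: "a \<in> gr_reps" "x = gr_class a" using assms(1) by (rule gr_carrierE)
  have "P (gr_class a)" if "finite S" "{k. a k \<noteq> 0} \<subseteq> S" "\<And>k. a k \<in> E (int k)" for S a
    using that
  proof (induction S arbitrary: a)
    case empty
    then have "gr_class a = elt 0 0" by (auto simp: elt_eq_class gr_class_eq_iff)
    then show ?case using elt[of 0 0] by simp
  next
    case (insert n S)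
    let ?b = "a(n := 0)"
    have b: "{k. ?b k \<noteq> 0} \<subseteq> S" "\<And>k. ?b k \<in> E (int k)" using insert by auto
    then have "?b \<in> gr_reps"
      using finite_subset[OF b(1) insert.hyps(1)] by (simp only: gr_reps_def) blast
    moreover have "P (gr_class ?b)" using b by (rule insert.IH)
    moreover have "gr_class a = elt (int n) (a n) \<oplus>\<^bsub>G\<^esub> gr_class ?b"
      unfolding elt_eq_class gr_add by (auto intro!: arg_cong[where f = gr_class])
    ultimately show ?case
      using insert.prems(2) by (simp only: gr_class_closed add elt elt_closed)
  qed
  then show ?thesis using a by (auto simp: gr_reps_def)
qed

text \<open>Serves skew symmetry, where the length of the sum depends on the elements. Two eventual
  statements hold jointly, so the additive step of \<open>gr_induct\<close> still goes
  through.\<close>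

lemma linear_endo_eventually_eqI:
  assumes f: "linear_endo complex_ring G f" and g: "\<And>N. linear_endo complex_ring G (g N)"
    and elt: "\<And>d a. a \<in> E d \<Longrightarrow> \<forall>\<^sub>F N in F. f (elt d a) = g N (elt d a)"
    and "x \<in> carrier G"
  shows "\<forall>\<^sub>F N in F. f x = g N x"
  using assms(4)
proof (induction rule: gr_induct)
  case (elt d a)
  then show ?case by (rule assms(3))
next
  case (add x y)
  from add(3,4) show ?case
    by eventually_elim (use f g add(1,2) in \<open>auto simp: linear_endo_def\<close>)
qed

text \<open>Applied to one argument after another, this reduces a multilinear identity to
  homogeneous elements.\<close>

lemma linear_endo_eqI:
  assumes "linear_endo complex_ring G f" "linear_endo complex_ring G g"
    and "\<And>d a. a \<in> E d \<Longrightarrow> f (elt d a) = g (elt d a)" and "x \<in> carrier G"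
  shows "f x = g x"
  using linear_endo_eventually_eqI[of f "\<lambda>_. g" sequentially x] assms by simp

lemma linear_endo_gr_mode_right:
  assumes "x \<in> carrier G" "N \<ge> -1"
  shows "linear_endo complex_ring G (gr_mode N x)"
  unfolding linear_endo_def using assms
  by (auto elim!: gr_carrierE simp: gr_mode_class gr_reps_mode gr_reps_add gr_reps_scale gr_add
      gr_smult Y_add_right Y_scale_right sum.distrib scale_sum_right)

lemma linear_endo_gr_mode_left:
  assumes "y \<in> carrier G" "N \<ge> -1"
  shows "linear_endo complex_ring G (\<lambda>x. gr_mode N x y)"
  unfolding linear_endo_def using assms
  by (auto elim!: gr_carrierE simp: gr_mode_class gr_reps_mode gr_reps_add gr_reps_scale gr_add
      gr_smult Y_add_left Y_scale_left sum.distrib scale_sum_right)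

lemma linear_endo_gr_D: "linear_endo complex_ring G (gr_D scale vac Y)"
  unfolding linear_endo_def
  by (auto elim!: gr_carrierE simp: gr_D_class gr_reps_D gr_reps_add gr_reps_scale gr_add
      gr_smult D_add D_scale gr_class_eq_iff)

lemma gr_mode_closed: "x \<in> carrier G \<Longrightarrow> y \<in> carrier G \<Longrightarrow> N \<ge> -1 \<Longrightarrow> gr_mode N x y \<in> carrier G"
  by (rule linear_endo_closed[OF linear_endo_gr_mode_right])

text \<open>Discharges the linearity conditions left by the two preceding principles. Composition
  appears only with a fixed kind of outer map, since the general rule would match every
  goal.\<close>

lemmas linear_endo_intros =
  linear_endo_gr_mode_right linear_endo_gr_mode_left linear_endo_gr_D linear_endo_id
  gr.linear_endo_zero gr.linear_endo_add gr.linear_endo_minus gr.linear_endo_smult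
  gr.linear_endo_finsum
  linear_endo_comp[OF linear_endo_gr_mode_right] linear_endo_comp[OF linear_endo_gr_mode_left]
  linear_endo_comp[OF linear_endo_gr_D] linear_endo_comp[OF linear_endo_funpow[OF linear_endo_gr_D]]

section \<open>The commutative algebra and its derivations\<close>

lemma gr_mult_commute:
  assumes "x \<in> carrier G" "y \<in> carrier G"
  shows "gr_mode (-1) x y = gr_mode (-1) y x"
proof (rule linear_endo_eqI[OF _ _ _ assms(1)])
  fix d a assume a: "a \<in> E d"
  show "gr_mode (-1) (elt d a) y = gr_mode (-1) y (elt d a)"
  proof (rule linear_endo_eqI[OF _ _ _ assms(2)])
    fix e b assume b: "b \<in> E e"
    show "gr_mode (-1) (elt d a) (elt e b) = gr_mode (-1) (elt e b) (elt d a)"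
      using mult_commute_E[OF a b] by (simp add: gr_mode_elt a b add.commute elt_eqI)
  qed (auto intro!: linear_endo_intros simp: elt_closed a)
qed (auto intro!: linear_endo_intros simp: assms)

lemma mult_elt:
  "a \<in> E r \<Longrightarrow> b \<in> E s \<Longrightarrow> gr_mode (-1) (elt r a) (elt s b) = elt (r + s) (Y a (-1) b)"
  by (simp add: gr_mode_elt)

lemma mode_E_nonneg: "a \<in> E r \<Longrightarrow> b \<in> E s \<Longrightarrow> Y a (int n) b \<in> E (r + s - int n)"
  and mode_E_mult: "a \<in> E r \<Longrightarrow> b \<in> E s \<Longrightarrow> Y a (-1) b \<in> E (r + s)"
  by (rule mode_E[where r = r and s = s]; simp)+

lemma gr_mult_assoc:
  assumes "x \<in> carrier G" "y \<in> carrier G" "z \<in> carrier G"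
  shows "gr_mode (-1) (gr_mode (-1) x y) z = gr_mode (-1) x (gr_mode (-1) y z)"
proof (rule linear_endo_eqI[OF _ _ _ assms(1)])
  fix d a assume a: "a \<in> E d"
  show "gr_mode (-1) (gr_mode (-1) (elt d a) y) z = gr_mode (-1) (elt d a) (gr_mode (-1) y z)"
  proof (rule linear_endo_eqI[OF _ _ _ assms(2)])
    fix e b assume b: "b \<in> E e"
    show "gr_mode (-1) (gr_mode (-1) (elt d a) (elt e b)) z
        = gr_mode (-1) (elt d a) (gr_mode (-1) (elt e b) z)"
    proof (rule linear_endo_eqI[OF _ _ _ assms(3)])
      fix f c assume c: "c \<in> E f"
      show "gr_mode (-1) (gr_mode (-1) (elt d a) (elt e b)) (elt f c)
          = gr_mode (-1) (elt d a) (gr_mode (-1) (elt e b) (elt f c))"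
        using mult_assoc_E[OF a b c]
        by (simp add: mult_elt mode_E_mult a b c add.assoc elt_eqI)
    qed (auto intro!: linear_endo_intros gr_mode_closed simp: elt_closed a b)
  qed (auto intro!: linear_endo_intros gr_mode_closed simp: elt_closed a assms)
qed (auto intro!: linear_endo_intros gr_mode_closed simp: assms)

lemma gr_one_closed: "elt 0 vac \<in> carrier G"
  by (simp add: elt_closed E_nonpos)

lemma gr_mult_one: "x \<in> carrier G \<Longrightarrow> gr_mode (-1) (elt 0 vac) x = x"
proof (erule linear_endo_eqI[rotated 3])
  fix d a assume "a \<in> E d"
  then show "gr_mode (-1) (elt 0 vac) (elt d a) = elt d a"
    by (simp add: mult_elt E_nonpos vacuum)
qed (auto intro!: linear_endo_intros gr_one_closed)

lemma gr_algebra: "algebra complex_ring G"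
proof (intro algebra.intro algebra_axioms.intro)
  show "cring G"
  proof (rule cringI)
    show "comm_monoid G"
      by (rule comm_monoidI)
        (auto simp: gr_mult_eq gr_one gr_mode_closed gr_mult_one gr_one_closed gr_mult_assoc
          intro: gr_mult_commute)
  next
    fix x y z assume "x \<in> carrier G" "y \<in> carrier G" "z \<in> carrier G"
    then show "(x \<oplus>\<^bsub>G\<^esub> y) \<otimes>\<^bsub>G\<^esub> z = x \<otimes>\<^bsub>G\<^esub> z \<oplus>\<^bsub>G\<^esub> y \<otimes>\<^bsub>G\<^esub> z"
      using linear_endo_gr_mode_left[of z "-1"] by (simp add: gr_mult_eq linear_endo_def)
  qed (rule gr.abelian_group_axioms)
next
  fix c x y assume "x \<in> carrier G" "y \<in> carrier G"
  then show "c \<odot>\<^bsub>G\<^esub> x \<otimes>\<^bsub>G\<^esub> y = c \<odot>\<^bsub>G\<^esub> (x \<otimes>\<^bsub>G\<^esub> y)"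
    using linear_endo_gr_mode_left[of y "-1"] by (simp add: gr_mult_eq linear_endo_def)
qed (rule gr_module)

lemma gr_D_derivation: "derivation complex_ring G (gr_D scale vac Y)"
proof -
  let ?D = "gr_D scale vac Y" and ?m = "gr_mode (-1)"
  have "?D (?m x y) = ?m (?D x) y \<oplus>\<^bsub>G\<^esub> ?m x (?D y)"
    if x: "x \<in> carrier G" and y: "y \<in> carrier G" for x y
  proof (rule linear_endo_eqI[OF _ _ _ x])
    fix d a assume a: "a \<in> E d"
    show "?D (?m (elt d a) y) = ?m (?D (elt d a)) y \<oplus>\<^bsub>G\<^esub> ?m (elt d a) (?D y)"
    proof (rule linear_endo_eqI[OF _ _ _ y])
      fix e b assume b: "b \<in> E e"
      have "?D (?m (elt d a) (elt e b)) = elt (d + e + 1) (D (Y a (-1) b))"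
        using a b by (simp add: mult_elt gr_D_elt mode_E_mult)
      moreover have "?m (?D (elt d a)) (elt e b) = elt (d + e + 1) (Y (D a) (-1) b)"
        "?m (elt d a) (?D (elt e b)) = elt (d + e + 1) (Y a (-1) (D b))"
        using mult_elt[OF D_E[OF a] b] mult_elt[OF a D_E[OF b]]
        by (simp_all only: gr_D_elt a b) (simp_all add: algebra_simps)
      ultimately show "?D (?m (elt d a) (elt e b))
          = ?m (?D (elt d a)) (elt e b) \<oplus>\<^bsub>G\<^esub> ?m (elt d a) (?D (elt e b))"
        by (simp only: elt_add D_derivation)
    qed (auto intro!: linear_endo_intros linear_endo_closed[OF linear_endo_gr_D] simp: elt_closed a)
  qed (auto intro!: linear_endo_intros linear_endo_closed[OF linear_endo_gr_D] simp: y)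
  then show ?thesis
    by (simp add: derivation_def linear_endo_gr_D gr_mult_eq)
qed

lemma gr_mode_derivation:
  assumes x: "x \<in> carrier G" shows "derivation complex_ring G (gr_mode (int n) x)"
proof -
  let ?n = "gr_mode (int n)" and ?m = "gr_mode (-1)"
  have "?n x (?m y z) = ?m (?n x y) z \<oplus>\<^bsub>G\<^esub> ?m y (?n x z)"
    if y: "y \<in> carrier G" and z: "z \<in> carrier G" for y z
  proof (rule linear_endo_eqI[OF _ _ _ x])
    fix d a assume a: "a \<in> E d"
    show "?n (elt d a) (?m y z) = ?m (?n (elt d a) y) z \<oplus>\<^bsub>G\<^esub> ?m y (?n (elt d a) z)"
    proof (rule linear_endo_eqI[OF _ _ _ y])
      fix e b assume b: "b \<in> E e"
      show "?n (elt d a) (?m (elt e b) z)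
        = ?m (?n (elt d a) (elt e b)) z \<oplus>\<^bsub>G\<^esub> ?m (elt e b) (?n (elt d a) z)"
      proof (rule linear_endo_eqI[OF _ _ _ z])
        fix f c assume c: "c \<in> E f"
        let ?d = "d + e + f - int n"
        have "?n (elt d a) (?m (elt e b) (elt f c)) = elt ?d (Y a (int n) (Y b (-1) c))"
          using a b c by (simp add: gr_mode_elt mult_elt mode_E_mult add_ac)
        moreover have "?m (?n (elt d a) (elt e b)) (elt f c) = elt ?d (Y (Y a (int n) b) (-1) c)"
          using a b c by (simp add: gr_mode_elt[where N = "int n"] mult_elt mode_E_nonneg algebra_simps)
        moreover have "?m (elt e b) (?n (elt d a) (elt f c)) = elt ?d (Y b (-1) (Y a (int n) c))"
          using a b c by (simp add: gr_mode_elt[where N = "int n"] mult_elt mode_E_nonneg algebra_simps)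
        ultimately show "?n (elt d a) (?m (elt e b) (elt f c))
          = ?m (?n (elt d a) (elt e b)) (elt f c) \<oplus>\<^bsub>G\<^esub> ?m (elt e b) (?n (elt d a) (elt f c))"
          \<comment> \<open>The Leibniz rule fails in the vertex algebra only by a term of higher
            degree, which the class in degree \<open>?d\<close> does not see.\<close>
          by (simp only: elt_add) (rule elt_eqI[OF mode_derivation_E[OF a b c]])
      qed (auto intro!: linear_endo_intros gr_mode_closed simp: elt_closed a b)
    qed (auto intro!: linear_endo_intros gr_mode_closed simp: elt_closed a z)
  qed (auto intro!: linear_endo_intros gr_mode_closed simp: y z)
  then show ?thesis
    using x by (simp add: derivation_def linear_endo_gr_mode_right gr_mult_eq)
qed

section \<open>The vertex Lie structure\<close>

lemma gr_D_mode:
  assumes v: "v \<in> carrier G" and w: "w \<in> carrier G"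
  shows "gr_mode (int n) (gr_D scale vac Y v) w =
    (if n = 0 then \<zero>\<^bsub>G\<^esub> else (- of_nat n) \<odot>\<^bsub>G\<^esub> gr_mode (int (n - 1)) v w)"
proof -
  have lin: "linear_endo complex_ring G (\<lambda>w. if n = 0 then \<zero>\<^bsub>G\<^esub> else (- of_nat n) \<odot>\<^bsub>G\<^esub> gr_mode (int (n - 1)) v w)"
    if "v \<in> carrier G" for v
    using that by (cases "n = 0") (auto intro!: linear_endo_intros)
  have lin': "linear_endo complex_ring G (\<lambda>v. if n = 0 then \<zero>\<^bsub>G\<^esub> else (- of_nat n) \<odot>\<^bsub>G\<^esub> gr_mode (int (n - 1)) v w)"
    using w by (cases "n = 0") (auto intro!: linear_endo_intros)
  show ?thesis
  proof (rule linear_endo_eqI[OF _ lin' _ v])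
    fix d a assume a: "a \<in> E d"
    show "gr_mode (int n) (gr_D scale vac Y (elt d a)) w =
      (if n = 0 then \<zero>\<^bsub>G\<^esub> else (- of_nat n) \<odot>\<^bsub>G\<^esub> gr_mode (int (n - 1)) (elt d a) w)"
    proof (rule linear_endo_eqI[OF _ lin _ w])
      fix e b assume b: "b \<in> E e"
      show "gr_mode (int n) (gr_D scale vac Y (elt d a)) (elt e b) =
        (if n = 0 then \<zero>\<^bsub>G\<^esub> else (- of_nat n) \<odot>\<^bsub>G\<^esub> gr_mode (int (n - 1)) (elt d a) (elt e b))"
      proof (cases n)
        case 0
        then show ?thesis using a b by (simp add: gr_D_elt gr_mode_elt D_E D_mode elt_eq_zero)
      next
        case (Suc m)
        have "gr_mode (int n) (gr_D scale vac Y (elt d a)) (elt e b)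
            = elt (d + e - int m) (scale (- of_nat n) (Y a (int m) b))"
          using gr_mode_elt[OF D_E[OF a] b, of "int n"] a
          by (simp add: gr_D_elt D_mode Suc add_diff_eq flip: scale_minus_left)
        then show ?thesis using a b by (simp add: gr_mode_elt elt_smult Suc)
      qed
    qed (auto intro!: linear_endo_intros linear_endo_closed[OF linear_endo_gr_D] simp: elt_closed a)
  qed (auto intro!: linear_endo_intros simp: w)
qed

text \<open>All summands on the right have the same degree: the inner mode lowers it by
  \<open>i\<close> and the outer one by \<open>m + n - i\<close>. The commutator formula is thus
  homogeneous and passes to classes without corrections.\<close>

lemma gr_commutator:
  assumes u: "u \<in> carrier G" and v: "v \<in> carrier G" and w: "w \<in> carrier G"
  shows "gr_mode (int m) u (gr_mode (int n) v w) \<ominus>\<^bsub>G\<^esub> gr_mode (int n) v (gr_mode (int m) u w) =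
    (\<Oplus>\<^bsub>G\<^esub>i\<in>{..m}. of_nat (m choose i) \<odot>\<^bsub>G\<^esub> gr_mode (int (m + n - i)) (gr_mode (int i) u v) w)"
    (is "?L u v w = ?R u v w")
proof (rule linear_endo_eqI[OF _ _ _ u])
  fix d a assume a: "a \<in> E d"
  show "?L (elt d a) v w = ?R (elt d a) v w"
  proof (rule linear_endo_eqI[OF _ _ _ v])
    fix e b assume b: "b \<in> E e"
    show "?L (elt d a) (elt e b) w = ?R (elt d a) (elt e b) w"
    proof (rule linear_endo_eqI[OF _ _ _ w])
      fix f c assume c: "c \<in> E f"
      let ?d = "d + e + f - int m - int n"
      have summand: "of_nat (m choose i) \<odot>\<^bsub>G\<^esub> gr_mode (int (m + n - i)) (gr_mode (int i) (elt d a) (elt e b)) (elt f c)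
        = elt ?d (scale (of_nat (m choose i)) (Y (Y a (int i) b) (int m + int n - int i) c))"
        "scale (of_nat (m choose i)) (Y (Y a (int i) b) (int m + int n - int i) c) \<in> E ?d"
        if "i \<le> m" for i
      proof -
        have i: "int (m + n - i) = int m + int n - int i" using that by simp
        have "Y (Y a (int i) b) (int m + int n - int i) c \<in> E ?d"
          using mode_E_nonneg[OF mode_E_nonneg[OF a b, of i] c, of "m + n - i"]
          by (simp add: i algebra_simps)
        then show "scale (of_nat (m choose i)) (Y (Y a (int i) b) (int m + int n - int i) c) \<in> E ?d"
          by (rule E_scale)
        have "gr_mode (int (m + n - i)) (gr_mode (int i) (elt d a) (elt e b)) (elt f c)
          = elt (d + e - int i + f - int (m + n - i)) (Y (Y a (int i) b) (int (m + n - i)) c)"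
          using a b c by (simp add: gr_mode_elt mode_E_nonneg del: of_nat_diff)
        then show "of_nat (m choose i) \<odot>\<^bsub>G\<^esub> gr_mode (int (m + n - i)) (gr_mode (int i) (elt d a) (elt e b)) (elt f c)
          = elt ?d (scale (of_nat (m choose i)) (Y (Y a (int i) b) (int m + int n - int i) c))"
          by (simp add: i elt_smult algebra_simps)
      qed
      have "?R (elt d a) (elt e b) (elt f c)
         = (\<Oplus>\<^bsub>G\<^esub>i\<in>{..m}. elt ?d (scale (of_nat (m choose i)) (Y (Y a (int i) b) (int m + int n - int i) c)))"
        by (rule gr.finsum_cong') (auto simp: summand simp del: of_nat_diff intro!: elt_closed)
      also have "\<dots> = elt ?d (\<Sum>i\<le>m. scale (of_nat (m choose i)) (Y (Y a (int i) b) (int m + int n - int i) c))"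
        by (rule elt_sum) (auto simp: summand)
      also have "\<dots> = elt ?d (Y a (int m) (Y b (int n) c) - Y b (int n) (Y a (int m) c))"
        by (simp add: commutator_formula)
      also have "\<dots> = elt ?d (Y a (int m) (Y b (int n) c)) \<ominus>\<^bsub>G\<^esub> elt ?d (Y b (int n) (Y a (int m) c))"
        using mode_E_nonneg[OF a mode_E_nonneg[OF b c, of n], of m]
          mode_E_nonneg[OF b mode_E_nonneg[OF a c, of m], of n]
        by (intro elt_minus[symmetric]) (simp_all add: algebra_simps)
      also have "\<dots> = ?L (elt d a) (elt e b) (elt f c)"
        using a b c by (simp add: gr_mode_elt mode_E_nonneg algebra_simps)
      finally show "?L (elt d a) (elt e b) (elt f c) = ?R (elt d a) (elt e b) (elt f c)" by simp
    qed (auto intro!: linear_endo_intros gr_mode_closed simp: elt_closed a b)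
  qed (auto intro!: linear_endo_intros gr_mode_closed simp: elt_closed a w)
qed (auto intro!: linear_endo_intros gr_mode_closed simp: v w)

lemma funpow_gr_D_elt:
  "a \<in> E d \<Longrightarrow> (gr_D scale vac Y ^^ i) (elt d a) = elt (d + int i) ((D ^^ i) a)"
  by (induction i) (auto simp: gr_D_elt funpow_D_E add_ac)

text \<open>Homogeneous again: the mode \<open>m + i\<close> lowers the degree by
  \<open>m + i\<close> and the \<open>i\<close>-th power of \<open>D\<close> restores
  \<open>i\<close>, so every summand has the degree of the left side.\<close>

lemma gr_skew_symmetry:
  assumes u: "u \<in> carrier G" and v: "v \<in> carrier G"
  shows "\<forall>\<^sub>F N in sequentially. gr_mode (int m) u v =
    (\<Oplus>\<^bsub>G\<^esub>i\<in>{..<N}. ((-1) ^ (m + i + 1) * (1 / fact i)) \<odot>\<^bsub>G\<^esub>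
      (gr_D scale vac Y ^^ i) (gr_mode (int (m + i)) v u))"
    (is "\<forall>\<^sub>F N in sequentially. ?L u v = ?R N u v")
proof (rule linear_endo_eventually_eqI[OF _ _ _ u])
  fix d a assume a: "a \<in> E d"
  show "\<forall>\<^sub>F N in sequentially. ?L (elt d a) v = ?R N (elt d a) v"
  proof (rule linear_endo_eventually_eqI[OF _ _ _ v])
    fix e b assume b: "b \<in> E e"
    let ?d = "d + e - int m"
    let ?t = "\<lambda>i. scale ((-1) ^ (m + i + 1) * (1 / fact i)) ((D ^^ i) (Y b (int (m + i)) a))"
    have "\<forall>\<^sub>F N in sequentially. Y a (int m) b = sum ?t {..<N}"
    proof -
      have "(-1::complex) powi (int m + int i + 1) = (-1) ^ (m + i + 1)" for i
        by (metis of_nat_1 of_nat_add power_int_of_nat)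
      then show ?thesis using skew_symmetry[of a "int m" b] by simp
    qed
    then show "\<forall>\<^sub>F N in sequentially. ?L (elt d a) (elt e b) = ?R N (elt d a) (elt e b)"
    proof eventually_elim
      case (elim N)
      have t: "?t i \<in> E ?d" for i
        using funpow_D_E[OF mode_E_nonneg[OF b a, of "m + i"], of i]
        by (intro E_scale) (simp add: algebra_simps)
      have "?R N (elt d a) (elt e b) = (\<Oplus>\<^bsub>G\<^esub>i\<in>{..<N}. elt ?d (?t i))"
      proof (rule gr.finsum_cong')
        fix i
        have "gr_mode (int (m + i)) (elt e b) (elt d a)
            = elt (e + d - int (m + i)) (Y b (int (m + i)) a)"
          using a b by (simp add: gr_mode_elt)
        then have "(gr_D scale vac Y ^^ i) (gr_mode (int (m + i)) (elt e b) (elt d a))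
            = elt ?d ((D ^^ i) (Y b (int (m + i)) a))"
          using funpow_gr_D_elt[OF mode_E_nonneg[OF b a, of "m + i"], of i]
          by (simp add: algebra_simps)
        then show "((-1) ^ (m + i + 1) * (1 / fact i)) \<odot>\<^bsub>G\<^esub>
            (gr_D scale vac Y ^^ i) (gr_mode (int (m + i)) (elt e b) (elt d a)) = elt ?d (?t i)"
          by (simp only: elt_smult)
      qed (simp_all only: elt_closed t Pi_I)
      also have "\<dots> = elt ?d (sum ?t {..<N})"
        by (rule elt_sum) (simp_all only: t finite_lessThan)
      also have "\<dots> = ?L (elt d a) (elt e b)"
        using a b elim by (simp add: gr_mode_elt)
      finally show ?case by simp
    qed
  qed (auto intro!: linear_endo_intros simp: elt_closed a)
qed (auto intro!: linear_endo_intros simp: v)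

text \<open>Degrees alone decide this: with components only up to \<open>A\<close> and
  \<open>B\<close>, a mode number above \<open>A + B\<close> would land in negative degree.\<close>

lemma gr_truncation:
  assumes "u \<in> carrier G" "v \<in> carrier G"
  shows "\<exists>N. \<forall>n\<ge>N. gr_mode (int n) u v = \<zero>\<^bsub>G\<^esub>"
proof -
  obtain a b where ab: "a \<in> gr_reps" "u = gr_class a" "b \<in> gr_reps" "v = gr_class b"
    using assms by (auto elim!: gr_carrierE)
  obtain A B where AB: "\<And>k. k > A \<Longrightarrow> a k = 0" "\<And>k. k > B \<Longrightarrow> b k = 0"
    using ab gr_reps_bound by metis
  have "Y (a r) (int n) (b (k + n - r)) = 0" if "n \<ge> A + B + 1" for n r k
  proof (cases "r > A")
    case False
    then have "b (k + n - r) = 0" using that by (intro AB) auto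
    then show ?thesis by simp
  qed (simp add: AB)
  then have "gr_mode (int n) u v = \<zero>\<^bsub>G\<^esub>" if "n \<ge> A + B + 1" for n
    using that ab by (simp add: gr_mode_class gr_zero)
  then show ?thesis by blast
qed

lemma gr_vertex_lie_algebra:
  "vertex_lie_algebra G (gr_D scale vac Y) (gr_Ym scale Y)"
proof (intro vertex_lie_algebra.intro vertex_lie_algebra_axioms.intro)
  fix u v m assume u: "u \<in> carrier G" and v: "v \<in> carrier G"
  let ?t = "\<lambda>i. ((-1) ^ (m + i + 1) * (1 / fact i)) \<odot>\<^bsub>G\<^esub>
      (gr_D scale vac Y ^^ i) (gr_Ym scale Y v (m + i) u)"
  have t: "?t i \<in> carrier G" for i
    using u v by (intro gr.smult_closed linear_endo_closed[OF linear_endo_funpow[OF linear_endo_gr_D]])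
      (auto simp: gr_Ym_eq intro: gr_mode_closed)
  obtain N0 where N0: "\<forall>n\<ge>N0. gr_Ym scale Y v n u = \<zero>\<^bsub>G\<^esub>"
    using gr_truncation[OF v u] by (auto simp: gr_Ym_eq)
  have "(gr_D scale vac Y ^^ i) \<zero>\<^bsub>G\<^esub> = \<zero>\<^bsub>G\<^esub>" for i
    using funpow_gr_D_elt[of 0 0 i] by (simp add: elt_eq_zero)
  then have t0: "?t i = \<zero>\<^bsub>G\<^esub>" if "i \<ge> N0" for i
    using N0 that by simp
  \<comment> \<open>The bound \<open>N \<ge> N0\<close> makes the range of summation contain the
    support of \<open>?t\<close>, so the sum over the support has the same value.\<close>
  have "\<forall>\<^sub>F N in sequentially. gr_Ym scale Y u m v = (\<Oplus>\<^bsub>G\<^esub>i\<in>{..<N}. ?t i) \<and> N \<ge> N0"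
    using gr_skew_symmetry[OF u v, of m]
    by (intro eventually_conj eventually_ge_at_top) (simp only: gr_Ym_eq)
  then obtain N where N: "gr_Ym scale Y u m v = (\<Oplus>\<^bsub>G\<^esub>i\<in>{..<N}. ?t i)" "N \<ge> N0"
    using eventually_happens' sequentially_bot by blast
  have "(\<Oplus>\<^bsub>G\<^esub>i\<in>{i. ?t i \<noteq> \<zero>\<^bsub>G\<^esub>}. ?t i) = (\<Oplus>\<^bsub>G\<^esub>i\<in>{..<N}. ?t i)"
  proof (rule gr.add.finprod_mono_neutral_cong_left)
    show "{i. ?t i \<noteq> \<zero>\<^bsub>G\<^esub>} \<subseteq> {..<N}"
    proof
      fix i assume "i \<in> {i. ?t i \<noteq> \<zero>\<^bsub>G\<^esub>}"
      then have "\<not> N0 \<le> i" using t0[of i] by blast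
      then show "i \<in> {..<N}" using N(2) by simp
    qed
    show "?t \<in> {..<N} \<rightarrow> carrier G" using t by (intro Pi_I)
  qed (simp_all only: finite_lessThan refl Diff_iff mem_Collect_eq not_not)
  then show "gr_Ym scale Y u m v = (let t = ?t in \<Oplus>\<^bsub>G\<^esub>i\<in>{i. t i \<noteq> \<zero>\<^bsub>G\<^esub>}. t i)"
    by (simp only: N(1) Let_def)
qed (auto simp: gr_Ym_eq gr_Ym_eq[abs_def] gr_module linear_endo_gr_D linear_endo_gr_mode_left gr_commutator
      linear_endo_gr_mode_right gr_truncation gr_D_mode)

lemma gr_vertex_poisson_algebra:
  "vertex_poisson_algebra G (gr_D scale vac Y) (gr_Ym scale Y)"
  by (intro vertex_poisson_algebra.intro vertex_poisson_algebra_axioms.intro gr_algebra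
      gr_vertex_lie_algebra gr_D_derivation) (simp add: gr_Ym_eq[abs_def] gr_mode_derivation)

section \<open>The grading\<close>

lemma finsum_components:
  assumes "finite S" "\<And>n. n \<in> S \<Longrightarrow> f n \<in> gr_component scale Y n"
  shows "(\<Oplus>\<^bsub>G\<^esub>n\<in>S. f n) = (\<lambda>k. if k \<in> S then f k k else E (int k + 1))"
  using assms
proof (induction S)
  case empty
  then show ?case by (simp only: gr.finsum_empty) (simp add: gr_def)
next
  case (insert n S)
  have "f i \<in> carrier G" if "i \<in> insert n S" for i
    using insert.prems[OF that] by (auto simp: gr_component_def elt_closed)
  then have f: "f n \<in> carrier G" "f \<in> S \<rightarrow> carrier G" by auto
  obtain a where a: "a \<in> E (int n)" "f n = elt (int n) a"
    using insert.prems by (auto simp: gr_component_def)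
  have "(\<Oplus>\<^bsub>G\<^esub>n\<in>insert n S. f n) k = (if k \<in> insert n S then f k k else E (int k + 1))" for k
  proof -
    have "(\<Oplus>\<^bsub>G\<^esub>n\<in>insert n S. f n) k = f n k + (if k \<in> S then f k k else E (int k + 1))"
      using insert f by (simp add: gr.finsum_insert) (simp add: gr_def)
    \<comment> \<open>The zero cosets contributed by the other degrees are absorbed, so in degree
      \<open>k\<close> only the \<open>k\<close>-th summand is visible.\<close>
    moreover have "f k k + E (int k + 1) = f k k" if "k \<in> insert n S" for k
      using insert.prems[OF that]
      by (auto simp only: gr_component_def gr_elt_def set_plus_rearrange3 E_plus_E simp_thms if_True)
    moreover have "f n k = E (int k + 1)" if "k \<noteq> n"
      using that by (auto simp: a gr_elt_def)
    ultimately show ?thesis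
      using insert.hyps by (cases "k = n") (auto simp: E_plus_E add.commute)
  qed
  then show ?case by blast
qed

lemma gr_nat_graded: "nat_graded_algebra complex_ring G (gr_component scale Y)"
proof (intro nat_graded_algebra.intro nat_graded_algebra_axioms.intro gr_algebra)
  show "submodule (gr_component scale Y n) complex_ring G" for n
  proof (rule gr.submoduleI)
    show "\<zero>\<^bsub>G\<^esub> \<in> gr_component scale Y n"
      unfolding gr_component_def by (rule image_eqI[of _ _ 0]) (simp_all add: elt_eq_zero)
    show "\<ominus>\<^bsub>G\<^esub> x \<in> gr_component scale Y n" if x: "x \<in> gr_component scale Y n" for x
    proof -
      obtain a where a: "a \<in> E (int n)" "x = elt (int n) a"
        using x by (auto simp: gr_component_def)
      have "\<ominus>\<^bsub>G\<^esub> x = elt (int n) 0 \<ominus>\<^bsub>G\<^esub> elt (int n) a"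
        using a elt_closed by (simp add: elt_eq_zero gr.minus_eq)
      also have "\<dots> = elt (int n) (- a)" using a by (simp add: elt_minus)
      finally show ?thesis using a by (auto simp: gr_component_def intro: E_neg)
    qed
  qed (auto simp: gr_component_def elt_closed elt_add elt_smult intro!: imageI E_add E_scale)
  show "x \<otimes>\<^bsub>G\<^esub> y \<in> gr_component scale Y (m + n)"
    if "x \<in> gr_component scale Y m" "y \<in> gr_component scale Y n" for x y m n
    using that by (auto simp: gr_component_def gr_mult_eq mult_elt intro!: imageI mode_E_mult)
  show "\<one>\<^bsub>G\<^esub> \<in> gr_component scale Y 0"
    by (auto simp: gr_component_def gr_one E_nonpos)
  fix x assume "x \<in> carrier G"
  then obtain a where a: "a \<in> gr_reps" "x = gr_class a" by (rule gr_carrierE)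
  let ?g = "\<lambda>n. elt (int n) (a n)"
  have zero: "\<zero>\<^bsub>G\<^esub> = (\<lambda>k. E (int k + 1))" by (simp add: gr_def)
  \<comment> \<open>Makes the support of the components that of \<open>x\<close> itself, which is
    finite by membership in the carrier.\<close>
  have g: "?g n = \<zero>\<^bsub>G\<^esub> \<longleftrightarrow> x n = E (int n + 1)" for n
    by (auto simp: zero a(2) gr_class_def gr_elt_def fun_eq_iff)
  have fin: "finite {n. ?g n \<noteq> \<zero>\<^bsub>G\<^esub>}"
    using \<open>x \<in> carrier G\<close> unfolding g by (simp add: gr_def gr_carrier_def)
  have comp: "?g n \<in> gr_component scale Y n" for n
    using gr_reps_E[OF a(1)] by (auto simp: gr_component_def)
  show "\<exists>!f. (\<forall>n. f n \<in> gr_component scale Y n) \<and> finite {n. f n \<noteq> \<zero>\<^bsub>G\<^esub>} \<and>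
      x = (\<Oplus>\<^bsub>G\<^esub>n\<in>{n. f n \<noteq> \<zero>\<^bsub>G\<^esub>}. f n)"
  proof (rule ex1I[of _ ?g])
    have "x = (\<Oplus>\<^bsub>G\<^esub>n\<in>{n. ?g n \<noteq> \<zero>\<^bsub>G\<^esub>}. ?g n)"
      unfolding finsum_components[of _ ?g, OF fin comp]
      by (rule ext) (simp only: g mem_Collect_eq, auto simp: a(2) gr_class_def gr_elt_def add.commute)
    then show "(\<forall>n. ?g n \<in> gr_component scale Y n) \<and> finite {n. ?g n \<noteq> \<zero>\<^bsub>G\<^esub>} \<and>
      x = (\<Oplus>\<^bsub>G\<^esub>n\<in>{n. ?g n \<noteq> \<zero>\<^bsub>G\<^esub>}. ?g n)"
      using fin comp by (intro conjI allI)
  next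
    fix f assume f: "(\<forall>n. f n \<in> gr_component scale Y n) \<and> finite {n. f n \<noteq> \<zero>\<^bsub>G\<^esub>} \<and>
      x = (\<Oplus>\<^bsub>G\<^esub>n\<in>{n. f n \<noteq> \<zero>\<^bsub>G\<^esub>}. f n)"
    then have x: "x = (\<lambda>k. if f k \<noteq> \<zero>\<^bsub>G\<^esub> then f k k else E (int k + 1))"
      using finsum_components[of "{n. f n \<noteq> \<zero>\<^bsub>G\<^esub>}" f] by simp
    have "f n k = ?g n k" for n k
    proof (cases "k = n")
      case True
      \<comment> \<open>Also valid when \<open>f n\<close> is zero, since its value at
        \<open>n\<close> is then the zero coset, the default in the formula for
        \<open>x\<close>.\<close>
      have "f n n = x n" unfolding x using zero by auto
      then show ?thesis by (simp add: True a(2) gr_class_def gr_elt_def add.commute)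
    next
      case False
      obtain b where "f n = elt (int n) b" using f by (auto simp: gr_component_def)
      then show ?thesis using False by (simp add: gr_elt_def)
    qed
    then show "f = ?g" by (intro ext)
  qed
qed

end

theorem theorem2p12:
  fixes scale :: "complex \<Rightarrow> 'v::ab_group_add \<Rightarrow> 'v" and vac :: 'v
    and Y :: "'v \<Rightarrow> int \<Rightarrow> 'v \<Rightarrow> 'v"
  assumes "vertex_algebra scale vac Y"
  shows
    "(\<forall>(r::nat) (s::nat). \<forall>a\<in>va_E scale Y (int r). \<forall>b\<in>va_E scale Y (int s).
        gr_elt scale Y (int r) a \<otimes>\<^bsub>gr scale vac Y\<^esub> gr_elt scale Y (int s) b
          = gr_elt scale Y (int r + int s) (Y a (-1) b))
     \<and> nat_graded_algebra complex_ring (gr scale vac Y) (gr_component scale Y)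
     \<and> \<one>\<^bsub>gr scale vac Y\<^esub> = gr_elt scale Y 0 vac
     \<and> (\<forall>n::nat. \<forall>u\<in>va_E scale Y (int n).
          gr_D scale vac Y (gr_elt scale Y (int n) u)
            = gr_elt scale Y (int n + 1) (va_D vac Y u))
     \<and> derivation complex_ring (gr scale vac Y) (gr_D scale vac Y)
     \<and> (\<forall>(r::nat) (s::nat) (n::nat). \<forall>a\<in>va_E scale Y (int r). \<forall>b\<in>va_E scale Y (int s).
          gr_Ym scale Y (gr_elt scale Y (int r) a) n (gr_elt scale Y (int s) b)
            = gr_elt scale Y (int r + int s - int n) (Y a (int n) b))
     \<and> vertex_poisson_algebra (gr scale vac Y) (gr_D scale vac Y) (gr_Ym scale Y)"
proof -
  interpret vertex_algebra scale vac Y by (rule assms)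
  show ?thesis
    by (simp add: gr_mult_eq gr_Ym_eq gr_mode_elt gr_one gr_D_elt gr_nat_graded gr_D_derivation
        gr_vertex_poisson_algebra)
qed

end
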